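(* Let $k$ be a perfect field of characteristic $2$ and let $C$ be a hyperelliptic curve of odd genus $g\ge3$, given by a smooth model in the weighted projective plane (weights $1,g+1,1$ for $X,Y,Z$) \[ C:\ Y^2+H_1(X,Z)Y=H_0(X,Z), \] where $H_1,H_0\in k[X,Z]$ are homogeneous of degrees $g+1$ and $2g+2$ respectively. Then the rank of the Hasse–Witt matrix of $C$ equals \[ g-\tfrac12\deg\gcd\!\Big(H_1,\ Z^{-1}\tfrac{\partial}{\partial X}H_1\Big). \] In particular, it is at least $\frac{g-1}{2}$, with equality if and only if $\frac{\partial}{\partial X}H_1=0$.
   Context: In characteristic $2$, $\frac{\partial}{\partial X}H_1$ is divisible by $Z$ for $H_1$ homogeneous of even degree $g+1$, so $Z^{-1}\frac{\partial}{\partial X}H_1$ is a polynomial. *)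

theory Defs
  imports
    "HOL-Computational_Algebra.Computational_Algebra"
    "HOL-Algebra.Algebraic_Closure_Type"
    "Jordan_Normal_Form.DL_Rank"
begin

hide_const (open) UnivPoly.coeff Rat.Fract

definition perfect_field :: "'a::field itself \<Rightarrow> bool" where
  "perfect_field _ \<longleftrightarrow> CHAR('a) = 0 \<or> surj (\<lambda>x::'a. x ^ CHAR('a))"

text \<open>
  Elements of \<open>k[X,Z]\<close> are rendered as \<open>'a poly poly\<close>, with \<open>X\<close> the outer and \<open>Z\<close> the inner
  variable.  Hence \<open>\<partial>/\<partial>X\<close> is \<^const>\<open>pderiv\<close>, and \<open>\<partial>/\<partial>Z\<close> is \<open>map_poly pderiv\<close>.
\<close>

abbreviation Z_var :: "'a::comm_ring_1 poly poly" where
  "Z_var \<equiv> [:[:0, 1:]:]"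

definition homogeneous :: "nat \<Rightarrow> 'a::zero poly poly \<Rightarrow> bool" where
  "homogeneous d H \<longleftrightarrow> (\<forall>i j. Polynomial.coeff (Polynomial.coeff H i) j \<noteq> 0 \<longrightarrow> i + j = d)"

text \<open>The zero polynomial gets total degree 0.\<close>

definition total_degree :: "'a::zero poly poly \<Rightarrow> nat" where
  "total_degree H = Max (insert 0 {i + j |i j. Polynomial.coeff (Polynomial.coeff H i) j \<noteq> 0})"

definition eval2 :: "('a::zero \<Rightarrow> 'b::comm_ring_1) \<Rightarrow> 'a poly poly \<Rightarrow> 'b \<Rightarrow> 'b \<Rightarrow> 'b" where
  "eval2 \<phi> H x z = poly (map_poly (\<lambda>c. poly (map_poly \<phi> c) z) H) x"

text \<open>
  Exactness of the division by \<open>Z\<close> of \<open>\<partial>H/\<partial>X\<close> in characteristic 2.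
\<close>

lemma Z_dvd_pderiv:
  fixes H :: "'a::field poly poly"
  assumes "CHAR('a) = 2" "homogeneous d H" "even d"
  shows "Z_var dvd pderiv H"
proof -
  have two: "(2::'a) = 0"
    using of_nat_CHAR[where 'a = 'a] assms(1) by simp
  have "[:0, 1:] dvd Polynomial.coeff (pderiv H) i" for i
  proof -
    have "Polynomial.coeff (Polynomial.coeff (pderiv H) i) 0 = 0"
    proof (cases "Suc i = d")
      case True
      then obtain m where "Suc i = 2 * m" using assms(3) by blast
      hence "(of_nat (Suc i) :: 'a poly) = of_nat (2 * m)" by simp
      also have "\<dots> = [:2 * of_nat m:]" by (simp add: of_nat_poly)
      also have "\<dots> = 0" by (simp add: two)
      finally show ?thesis by (simp only: coeff_pderiv) simp
    next
      case False
      hence "Polynomial.coeff (Polynomial.coeff H (Suc i)) 0 = 0"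
        using assms(2) unfolding homogeneous_def by force
      thus ?thesis by (simp add: coeff_pderiv of_nat_poly del: of_nat_Suc)
    qed
    thus ?thesis using poly_eq_0_iff_dvd[of "Polynomial.coeff (pderiv H) i" 0]
      by (simp add: poly_0_coeff_0)
  qed
  thus ?thesis by (simp add: const_poly_dvd_iff)
qed

text \<open>
  The weighted homogeneous equation \<open>Y\<^sup>2 + H1(X,Z) Y - H0(X,Z)\<close>, as a polynomial in \<open>Y\<close> over
  \<open>k[X,Z]\<close>, and its values at points over an extension.
\<close>

definition curve_eq :: "'a::comm_ring_1 poly poly \<Rightarrow> 'a poly poly \<Rightarrow> 'a poly poly poly" where
  "curve_eq H1 H0 = [:- H0, H1, 1:]"

definition eval3 ::
    "('a::zero \<Rightarrow> 'b::comm_ring_1) \<Rightarrow> 'a poly poly poly \<Rightarrow> 'b \<Rightarrow> 'b \<Rightarrow> 'b \<Rightarrow> 'b" where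
  "eval3 \<phi> F x y z = poly (map_poly (\<lambda>H. eval2 \<phi> H x z) F) y"

text \<open>
  Jacobian criterion over an algebraic closure, in weighted homogeneous coordinates.  The only
  point of the weighted plane with nontrivial isotropy, \<open>X = Z = 0\<close>, does not lie on the curve, and
  away from it the punctured affine cone is a torsor under the multiplicative group over the
  curve; so the curve is smooth iff its punctured cone is.

  No irreducibility has to be demanded separately: a smooth model is geometrically integral, since
  two components \<open>Y = A\<close> and \<open>Y = B\<close> would meet in a singular point wherever \<open>A - B\<close> vanishes.
\<close>

definition smooth_model :: "'a::field poly poly \<Rightarrow> 'a poly poly \<Rightarrow> bool" where
  "smooth_model H1 H0 \<longleftrightarrow>
     (\<forall>x y z :: 'a alg_closure. (x, y, z) \<noteq> (0, 0, 0) \<longrightarrow>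
        (let F = curve_eq H1 H0 in
          \<not> (eval3 to_ac F x y z = 0 \<and>
             eval3 to_ac (map_poly pderiv F) x y z = 0 \<and>
             eval3 to_ac (pderiv F) x y z = 0 \<and>
             eval3 to_ac (map_poly (map_poly pderiv) F) x y z = 0)))"

text \<open>
  The Hasse-Witt matrix is the matrix of the Frobenius on \<open>H\<^sup>1(C, \<O>)\<close>, which is computed here as
  the Cech cohomology of the structure sheaf for the affine charts \<open>Z \<noteq> 0\<close> and \<open>X \<noteq> 0\<close>, which
  cover \<open>C\<close>.  With \<open>x = X/Z\<close> and \<open>y = Y/Z\<^sup>(\<^sup>g\<^sup>+\<^sup>1\<^sup>)\<close>, regular functions on the charts and on their
  intersection are represented in \<open>k(x)[y]\<close>, modulo the equation
  \<open>f = y\<^sup>2 + H1(x,1) y - H0(x,1)\<close> of the curve: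
  the coordinate rings are \<open>k[x,y]/(f)\<close> for \<open>Z \<noteq> 0\<close>, the image of \<open>k[1/x, y/x\<^sup>(\<^sup>g\<^sup>+\<^sup>1\<^sup>)]\<close> for
  \<open>X \<noteq> 0\<close>, and \<open>k[x,1/x,y]/(f)\<close> for the intersection.
\<close>

inductive_set subalgebra ::
    "('a::comm_ring_1 \<Rightarrow> 'b::comm_ring_1) \<Rightarrow> 'b set \<Rightarrow> 'b set" for \<phi> S where
  const: "\<phi> c \<in> subalgebra \<phi> S"
| gen: "s \<in> S \<Longrightarrow> s \<in> subalgebra \<phi> S"
| add: "s \<in> subalgebra \<phi> S \<Longrightarrow> t \<in> subalgebra \<phi> S \<Longrightarrow> s + t \<in> subalgebra \<phi> S"
| mult: "s \<in> subalgebra \<phi> S \<Longrightarrow> t \<in> subalgebra \<phi> S \<Longrightarrow> s * t \<in> subalgebra \<phi> S"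

definition const_fn :: "'a::field \<Rightarrow> 'a poly fract poly" where
  "const_fn c = [:Fraction_Field.Fract [:c:] 1:]"

definition x_fn :: "'a::field poly fract poly" where
  "x_fn = [:Fraction_Field.Fract [:0, 1:] 1:]"

definition x_inv :: "'a::field poly fract poly" where
  "x_inv = [:Fraction_Field.Fract 1 [:0, 1:]:]"

definition y_fn :: "'a::field poly fract poly" where
  "y_fn = [:0, 1:]"

definition functions_Z :: "'a::field poly fract poly set" where
  "functions_Z = subalgebra const_fn {x_fn, y_fn}"

definition functions_X :: "nat \<Rightarrow> 'a::field poly fract poly set" where
  "functions_X g = subalgebra const_fn {x_inv, y_fn * x_inv ^ (g + 1)}"

definition functions_XZ :: "'a::field poly fract poly set" where
  "functions_XZ = subalgebra const_fn {x_fn, x_inv, y_fn}"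

definition affine_eq :: "'a::field poly poly \<Rightarrow> 'a poly poly \<Rightarrow> 'a poly fract poly" where
  "affine_eq H1 H0 = eval3 const_fn (curve_eq H1 H0) x_fn y_fn 1"

text \<open>
  \<open>H\<^sup>1(C, \<O>)\<close> is the quotient of \<^const>\<open>functions_XZ\<close> by the following \<open>k\<close>-subspace, which contains
  the ideal generated by the equation of the curve.
\<close>

definition coboundaries ::
    "nat \<Rightarrow> 'a::field poly poly \<Rightarrow> 'a poly poly \<Rightarrow> 'a poly fract poly set" where
  "coboundaries g H1 H0 =
     {a + b + affine_eq H1 H0 * c |a b c.
        a \<in> functions_Z \<and> b \<in> functions_X g \<and> c \<in> functions_XZ}"

text \<open>\<open>b 0, \<dots>, b (g - 1)\<close> represent a \<open>k\<close>-basis of \<open>H\<^sup>1(C, \<O>)\<close>.\<close>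

definition cohomology_basis ::
    "nat \<Rightarrow> 'a::field poly poly \<Rightarrow> 'a poly poly \<Rightarrow> (nat \<Rightarrow> 'a poly fract poly) \<Rightarrow> bool" where
  "cohomology_basis g H1 H0 b \<longleftrightarrow>
     (\<forall>i<g. b i \<in> functions_XZ) \<and>
     (\<forall>s\<in>functions_XZ. \<exists>c. s - (\<Sum>i<g. const_fn (c i) * b i) \<in> coboundaries g H1 H0) \<and>
     (\<forall>c. (\<Sum>i<g. const_fn (c i) * b i) \<in> coboundaries g H1 H0 \<longrightarrow> (\<forall>i<g. c i = 0))"

text \<open>
  The matrix depends on the basis: a change of basis \<open>P\<close> replaces \<open>A\<close> by \<open>P\<^sup>-\<^sup>1 A P\<^sup>(\<^sup>p\<^sup>)\<close>, where
  \<open>P\<^sup>(\<^sup>p\<^sup>)\<close> is \<open>P\<close> with the Frobenius applied to its entries.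
\<close>

definition hasse_witt_matrix ::
    "nat \<Rightarrow> 'a::field poly poly \<Rightarrow> 'a poly poly \<Rightarrow> 'a mat \<Rightarrow> bool" where
  "hasse_witt_matrix g H1 H0 A \<longleftrightarrow>
     A \<in> carrier_mat g g \<and>
     (\<exists>b. cohomology_basis g H1 H0 b \<and>
        (\<forall>j<g. b j ^ CHAR('a) - (\<Sum>i<g. const_fn (A $$ (i, j)) * b i) \<in> coboundaries g H1 H0))"

end

theory Submission
  imports Defs
begin

text \<open>
  Write \<open>h = H1(x,1)\<close> and \<open>f = H0(x,1)\<close>.  Modulo coboundaries a function \<open>u + v y\<close> on the overlap of
  the two charts is determined by the coefficients of \<open>x\<^sup>-\<^sup>1, \<dots>, x\<^sup>-\<^sup>g\<close> in \<open>v\<close>, so the classes of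
  \<open>y x\<^sup>-\<^sup>i\<close> form a basis of \<open>H\<^sup>1\<close>.  Since \<open>y\<^sup>2 = h y + f\<close>, Frobenius sends \<open>y x\<^sup>-\<^sup>j\<close> to \<open>h y x\<^sup>-\<^sup>2\<^sup>j\<close>, and
  the Hasse-Witt matrix has the entries \<open>h\<^sub>2\<^sub>j\<^sub>-\<^sub>i\<close>.  A row vector, read as a polynomial \<open>V\<close> of degree
  less than \<open>g\<close>, annihilates this matrix iff \<open>V h\<close> has no odd coefficients, that is, iff
  \<open>(V h)' = 0\<close>.  Let \<open>d = gcd h h'\<close> and \<open>h = d r\<close>.  Then \<open>d' = 0\<close>, and \<open>(V h)' = 0\<close> iff \<open>V = r w\<close> with
  \<open>w' = 0\<close>; such \<open>V\<close> form a space of dimension \<open>(g + 1 - deg r) div 2\<close>.  Homogenising, this is half the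
  degree of \<open>gcd(H1, Z\<^sup>-\<^sup>1 \<partial>H1/\<partial>X)\<close>.  Smoothness ensures \<open>H1 \<noteq> 0\<close>.
\<close>

no_notation fps_nth (infixl \<open>$\<close> 75)

section \<open>Rank of a matrix\<close>

context vec_space begin

text \<open>The columns of \<open>B * C\<close> are combinations of the \<open>r\<close> columns of
  \<open>B\<close>.\<close>

lemma rank_mult_le_inner:
  assumes B: "B \<in> carrier_mat n r" and C: "C \<in> carrier_mat r nc"
  shows "rank (B * C) \<le> r"
proof -
  let ?A = "B * C"
  have A: "?A \<in> carrier_mat n nc" using B C by simp
  have cA: "set (cols ?A) \<subseteq> carrier_vec n" and cB: "set (cols B) \<subseteq> carrier_vec n"
    using cols_dim[of ?A] cols_dim[of B] A B by auto
  have "v \<in> span (set (cols B))" if "v \<in> set (cols ?A)" for v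
  proof -
    have "v \<in> col ?A ` {0..<dim_col ?A}" using that unfolding cols_def by (simp only: set_map set_upt)
    then obtain j where j: "j < nc" "v = col ?A j" using A by auto
    have "v = B *\<^sub>v col C j" using j B C by auto
    moreover have "col C j \<in> carrier_vec r" using C by auto
    ultimately have "v \<in> col_space B"
      unfolding col_space_eq[OF B] using B j A by auto
    thus ?thesis by (simp add: col_space_def)
  qed
  hence sub: "span (set (cols ?A)) \<subseteq> span (set (cols B))"
    using cB by (intro span_subsetI) auto
  have sA: "subspace class_ring (span (set (cols ?A))) V"
    and sB: "subspace class_ring (span (set (cols B))) V"
    using cA cB span_is_subspace by auto
  have vB: "vectorspace class_ring (span_vs (set (cols B)))"
    using sB subspace_is_vs by blast
  have s: "subspace class_ring (span (set (cols ?A))) (span_vs (set (cols B)))"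
    using nested_subspaces[OF sB sA sub] .
  have eq: "(span_vs (set (cols B)))\<lparr>carrier := span (set (cols ?A))\<rparr> = span_vs (set (cols ?A))"
    by simp
  have "rank ?A \<le> rank B"
    using vectorspace.subspace_dim[OF vB s fin_dim_span_cols[OF B]] fin_dim_span_cols[OF A]
    unfolding rank_def eq by auto
  thus ?thesis using rank_le_nc[OF B] by simp
qed

text \<open>A maximal independent set of columns forms \<open>B\<close>, and the coordinates of all
  columns with respect to it form \<open>C\<close>. Rank comparisons then reduce to
  \<open>rank_mult_le_inner\<close>.\<close>

lemma rank_factorization:
  assumes A: "A \<in> carrier_mat n nc"
  obtains B C where "B \<in> carrier_mat n (rank A)" "C \<in> carrier_mat (rank A) nc" "A = B * C"
proof -
  have cA: "set (cols A) \<subseteq> carrier_vec n" using cols_dim[of A] A by auto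
  obtain S where max: "maximal S (\<lambda>T. T \<subseteq> set (cols A) \<and> lin_indpt T)"
    using maximal_exists_superset[of "set (cols A)" "\<lambda>T. T \<subseteq> set (cols A) \<and> lin_indpt T" "{}"]
      finite_lin_indpt2 by (metis List.finite_set empty_iff empty_subsetI finite.emptyI)
  have S: "S \<subseteq> set (cols A)" "lin_indpt S" using max by (auto simp: maximal_def)
  have finS: "finite S" using S(1) finite_subset by blast
  have ScA: "S \<subseteq> carrier_vec n" using S(1) cA by blast
  have r: "rank A = card S" using rank_card_indpt[OF A max] .
  have span: "v \<in> span S" if v: "v \<in> set (cols A)" for v
  proof (rule ccontr)
    assume nv: "v \<notin> span S"
    have "v \<notin> S" using nv span_mem[OF ScA] by blast
    moreover have "lin_indpt (S \<union> {v})"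
      using lin_dep_iff_in_span[of S v] nv ScA S(2) v cA \<open>v \<notin> S\<close> by auto
    ultimately show False using max v S(1) unfolding maximal_def by blast
  qed
  obtain xs where xs: "set xs = S" "distinct xs" using finite_distinct_list[OF finS] by blast
  have len: "length xs = rank A" using xs r distinct_card by fastforce
  define B where "B = mat_of_cols n xs"
  have B: "B \<in> carrier_mat n (rank A)" unfolding B_def len[symmetric] by simp
  have colsB: "cols B = xs" unfolding B_def by (rule cols_mat_of_cols) (use xs ScA in auto)
  have "\<exists>x. x \<in> carrier_vec (rank A) \<and> B *\<^sub>v x = col A j" if "j < nc" for j
  proof -
    have "col A j \<in> set (cols A)" using that A by (auto simp: cols_def)
    hence "col A j \<in> col_space B" unfolding col_space_def colsB xs(1) by (rule span)
    thus ?thesis unfolding col_space_eq[OF B] using B by auto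
  qed
  then obtain x where x: "\<And>j. j < nc \<Longrightarrow> x j \<in> carrier_vec (rank A) \<and> B *\<^sub>v x j = col A j"
    by metis
  define C where "C = mat_of_cols (rank A) (map x [0..<nc])"
  have C: "C \<in> carrier_mat (rank A) nc" by (rule carrier_matI) (simp_all add: C_def)
  have "A = B * C"
  proof (rule mat_col_eqI)
    fix j assume "j < dim_col (B * C)"
    hence j: "j < nc" using C by simp
    have "col (B * C) j = B *\<^sub>v col C j" by (rule col_mult2[OF B C j])
    also have "col C j = x j" unfolding C_def using j x by (subst col_mat_of_cols) auto
    finally show "col A j = col (B * C) j" using x j by simp
  qed (use A B C in auto)
  thus thesis using that B C by blast
qed

end

text \<open>Transposing a factorization of \<open>A\<close> through its rank factors the transpose
  with the same inner dimension.\<close>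

lemma rank_transpose_le:
  assumes A: "(A :: 'a::field mat) \<in> carrier_mat n m"
  shows "vec_space.rank m A\<^sup>T \<le> vec_space.rank n A"
proof -
  obtain B C where BC: "B \<in> carrier_mat n (vec_space.rank n A)"
      "C \<in> carrier_mat (vec_space.rank n A) m" "A = B * C"
    using vec_space.rank_factorization[OF A] by blast
  have "A\<^sup>T = C\<^sup>T * B\<^sup>T" using BC transpose_mult by metis
  thus ?thesis using vec_space.rank_mult_le_inner[of "C\<^sup>T" m _ "B\<^sup>T" n] BC by simp
qed

lemma rank_transpose:
  assumes "(A :: 'a::field mat) \<in> carrier_mat n m"
  shows "vec_space.rank m A\<^sup>T = vec_space.rank n A"
  using rank_transpose_le[OF assms] rank_transpose_le[of "A\<^sup>T" m n] assms by simp

lemma rank_mult_left_le: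
  assumes P: "(P :: 'a::field mat) \<in> carrier_mat k n" and A: "A \<in> carrier_mat n m"
  shows "vec_space.rank k (P * A) \<le> vec_space.rank n A"
proof -
  obtain B C where BC: "B \<in> carrier_mat n (vec_space.rank n A)"
      "C \<in> carrier_mat (vec_space.rank n A) m" "A = B * C"
    using vec_space.rank_factorization[OF A] by blast
  have "P * A = (P * B) * C" using BC(3) assoc_mult_mat[OF P BC(1,2)] by simp
  thus ?thesis using vec_space.rank_mult_le_inner[OF _ BC(2), of "P * B" k] P BC(1) by simp
qed

lemma invertible_left_inverse:
  assumes P: "(P :: 'a::field mat) \<in> carrier_mat n n" and d: "det P \<noteq> 0"
  obtains Q where "Q \<in> carrier_mat n n" "Q * P = 1\<^sub>m n"
  using det_non_zero_imp_unit[OF P d, of undefined]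
  unfolding Units_def ring_mat_def by auto

lemma rank_mult_left_invertible:
  assumes P: "(P :: 'a::field mat) \<in> carrier_mat n n" and d: "det P \<noteq> 0"
    and A: "A \<in> carrier_mat n m"
  shows "vec_space.rank n (P * A) = vec_space.rank n A"
proof (rule antisym)
  show "vec_space.rank n (P * A) \<le> vec_space.rank n A" by (rule rank_mult_left_le[OF P A])
  obtain Q where Q: "Q \<in> carrier_mat n n" "Q * P = 1\<^sub>m n" using invertible_left_inverse[OF P d] .
  have "A = Q * (P * A)" using assoc_mult_mat[OF Q(1) P A] Q(2) A by simp
  thus "vec_space.rank n A \<le> vec_space.rank n (P * A)"
    using rank_mult_left_le[OF Q(1), of "P * A" m] P A by simp
qed

lemma rank_mult_right_invertible:
  assumes P: "(P :: 'a::field mat) \<in> carrier_mat m m" and d: "det P \<noteq> 0"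
    and A: "A \<in> carrier_mat n m"
  shows "vec_space.rank n (A * P) = vec_space.rank n A"
proof -
  have "vec_space.rank n (A * P) = vec_space.rank m (P\<^sup>T * A\<^sup>T)"
    using rank_transpose[of "A * P" n m] transpose_mult[OF A P] A P by simp
  also have "\<dots> = vec_space.rank m A\<^sup>T"
    using rank_mult_left_invertible[of "P\<^sup>T" m "A\<^sup>T" n] d det_transpose[OF P] P A by simp
  finally show ?thesis using rank_transpose[OF A] by simp
qed

text \<open>The rank is the size of a maximal independent set of rows. Such a set omits the zero
  vector, so it consists of rows with index outside \<open>D\<close>.\<close>

lemma rank_le_card_nonzero_rows:
  assumes A: "(A :: 'a::field mat) \<in> carrier_mat n m" and D: "D \<subseteq> {..<n}"
    and z: "\<And>d. d \<in> D \<Longrightarrow> row A d = 0\<^sub>v m"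
  shows "vec_space.rank n A \<le> n - card D"
proof -
  interpret W: vec_space "TYPE('a)" m .
  let ?A = "A\<^sup>T"
  have A': "?A \<in> carrier_mat m n" using A by simp
  obtain S where max: "maximal S (\<lambda>T. T \<subseteq> set (cols ?A) \<and> W.lin_indpt T)"
    using maximal_exists_superset[of "set (cols ?A)" "\<lambda>T. T \<subseteq> set (cols ?A) \<and> W.lin_indpt T" "{}"]
      W.finite_lin_indpt2 by (metis List.finite_set empty_iff empty_subsetI finite.emptyI)
  have S: "S \<subseteq> set (cols ?A)" "W.lin_indpt S" using max by (auto simp: maximal_def)
  have "set (cols ?A) \<subseteq> carrier_vec m" using cols_dim[of ?A] unfolding carrier_matD(1)[OF A'] .
  moreover have "UNIV \<noteq> {0::'a}" by (metis UNIV_I singletonD zero_neq_one)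
  ultimately have "0\<^sub>v m \<notin> S" using W.zero_nin_lin_indpt[of S] S by auto
  have "S \<subseteq> row A ` ({..<n} - D)"
  proof
    fix v assume v: "v \<in> S"
    then obtain i where i: "i < n" "v = row A i" using S(1) A by (auto simp: cols_def)
    moreover have "i \<notin> D" using z i v \<open>0\<^sub>v m \<notin> S\<close> by auto
    ultimately show "v \<in> row A ` ({..<n} - D)" by auto
  qed
  hence "card S \<le> card ({..<n} - D)"
    by (meson card_image_le card_mono finite_Diff finite_imageI finite_lessThan order_trans)
  also have "\<dots> = n - card D" using D by (simp add: card_Diff_subset finite_subset)
  finally show ?thesis using W.rank_card_indpt[OF A' max] rank_transpose[OF A] by simp
qed

text \<open>\<open>D\<close> is the set of pivots of an echelon basis of the left kernel of \<open>A\<close>.\<close>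

lemma rank_eq_of_left_kernel_echelon:
  assumes A: "(A :: 'a::field mat) \<in> carrier_mat n m" and D: "D \<subseteq> {..<n}"
    and ker: "\<And>d. d \<in> D \<Longrightarrow> \<exists>v\<in>carrier_vec n. A\<^sup>T *\<^sub>v v = 0\<^sub>v m \<and> v $ d \<noteq> 0 \<and> (\<forall>i<n. d < i \<longrightarrow> v $ i = 0)"
    and piv: "\<And>v. v \<in> carrier_vec n \<Longrightarrow> A\<^sup>T *\<^sub>v v = 0\<^sub>v m \<Longrightarrow> (\<forall>d\<in>D. v $ d = 0) \<Longrightarrow> v = 0\<^sub>v n"
  shows "vec_space.rank n A = n - card D"
proof (rule antisym)
  obtain w where w: "\<And>d. d \<in> D \<Longrightarrow> w d \<in> carrier_vec n \<and> A\<^sup>T *\<^sub>v w d = 0\<^sub>v m \<and> w d $ d \<noteq> 0 \<and> (\<forall>i<n. d < i \<longrightarrow> w d $ i = 0)"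
    using ker by metis
  \<comment> \<open>The rows of the identity with index in \<open>D\<close> are replaced by the
    kernel vectors. The result is lower triangular with nonzero diagonal, and \<open>M * A\<close>
    has zero rows at \<open>D\<close>.\<close>
  define M where "M = mat n n (\<lambda>(i,j). if i \<in> D then w i $ j else if i = j then 1 else 0)"
  have M: "M \<in> carrier_mat n n" by (simp add: M_def)
  have "det M = prod_list (diag_mat M)"
    by (rule det_lower_triangular[OF _ M]) (use w in \<open>auto simp: M_def\<close>)
  also have "\<dots> \<noteq> 0" using w by (auto simp: prod_list_zero_iff diag_mat_def M_def)
  finally have dM: "det M \<noteq> 0" .
  have "row (M * A) d = 0\<^sub>v m" if d: "d \<in> D" for d
  proof (rule eq_vecI)
    have dn: "d < n" using d D by auto
    fix j assume "j < dim_vec (0\<^sub>v m :: 'a vec)"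
    hence j: "j < m" by simp
    have "row (M * A) d $ j = row M d \<bullet> col A j" using dn j M A by simp
    also have "row M d = w d" using d dn w[OF d] by (intro eq_vecI) (auto simp: M_def)
    also have "w d \<bullet> col A j = col A j \<bullet> w d"
      using w[OF d] A j by (intro comm_scalar_prod) auto
    also have "\<dots> = (A\<^sup>T *\<^sub>v w d) $ j" using A j by simp
    finally show "row (M * A) d $ j = 0\<^sub>v m $ j" using w[OF d] by simp
  qed (use A in auto)
  hence "vec_space.rank n (M * A) \<le> n - card D"
    using M A by (intro rank_le_card_nonzero_rows[OF _ D]) auto
  thus "vec_space.rank n A \<le> n - card D"
    using rank_mult_left_invertible[OF M dM A] by simp
next
  define r where "r = vec_space.rank n A"
  obtain B C where B: "B \<in> carrier_mat n r" and C: "C \<in> carrier_mat r m" and ABC: "A = B * C"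
    using vec_space.rank_factorization[OF A] unfolding r_def by blast
  show "n - card D \<le> vec_space.rank n A"
  proof (rule ccontr)
    assume "\<not> ?thesis"
    hence lt: "r + card D < n" by (simp add: r_def)
    have finD: "finite D" using D finite_subset by blast
    then obtain e where e: "bij_betw e {..<card D} D"
      using ex_bij_betw_nat_finite[OF finD] by (metis atLeast0LessThan)
    \<comment> \<open>The rows of \<open>K\<close> are the columns of \<open>B\<close>, the unit
      vectors at \<open>D\<close>, and zeros. As \<open>r + card D < n\<close>, a zero row remains
      and \<open>K\<close> is singular; a null vector lies in the left kernel of \<open>A\<close>
      and vanishes on \<open>D\<close>, against \<open>piv\<close>.\<close>
    define K where "K = mat n n (\<lambda>(i,j). if i < r then B $$ (j,i)
      else if i < r + card D then (if j = e (i - r) then 1 else 0) else 0)"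
    have K: "K \<in> carrier_mat n n" by (simp add: K_def)
    have "K\<^sup>T *\<^sub>v unit_vec n (r + card D) = 0\<^sub>v n"
      using lt by (intro eq_vecI) (auto simp: K_def)
    moreover have "unit_vec n (r + card D) \<noteq> (0\<^sub>v n :: 'a vec)" using lt by simp
    ultimately have "det K\<^sup>T = 0"
      using det_0_iff_vec_prod_zero_field[of "K\<^sup>T" n] K by (meson transpose_carrier_mat unit_vec_carrier)
    hence "det K = 0" using det_transpose[OF K] by simp
    then obtain v where v: "v \<in> carrier_vec n" "v \<noteq> 0\<^sub>v n" "K *\<^sub>v v = 0\<^sub>v n"
      using det_0_iff_vec_prod_zero_field[OF K] by blast
    have Kv: "row K i \<bullet> v = 0" if "i < n" for i
      using arg_cong[OF v(3), of "\<lambda>x. x $ i"] that K by simp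
    have "B\<^sup>T *\<^sub>v v = 0\<^sub>v r"
    proof (rule eq_vecI)
      fix i assume "i < dim_vec (0\<^sub>v r :: 'a vec)"
      hence i: "i < r" by simp
      have "row K i = col B i" using i lt B by (intro eq_vecI) (auto simp: K_def)
      thus "(B\<^sup>T *\<^sub>v v) $ i = 0\<^sub>v r $ i" using Kv[of i] i lt B by simp
    qed (use B in auto)
    hence "A\<^sup>T *\<^sub>v v = 0\<^sub>v m"
      unfolding ABC transpose_mult[OF B C]
      using assoc_mult_mat_vec[of "C\<^sup>T" m r "B\<^sup>T" n v] B C v(1) by auto
    moreover have "\<forall>d\<in>D. v $ d = 0"
    proof
      fix d assume d: "d \<in> D"
      then obtain k where k: "k < card D" "d = e k"
        using e by (auto simp: bij_betw_def)
      have dn: "d < n" using d D by auto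
      have "row K (r + k) = unit_vec n d"
        using k dn lt by (intro eq_vecI) (auto simp: K_def)
      thus "v $ d = 0" using Kv[of "r + k"] k lt v(1) dn by simp
    qed
    ultimately show False using piv v by blast
  qed
qed

section \<open>Laurent polynomials as functions on the curve\<close>

text \<open>The Laurent polynomial \<open>p / x^N\<close>, whose coefficient at
  \<open>x^(-i)\<close> is that of \<open>p\<close> at \<open>N - i\<close>. The pair
  \<open>(N, p)\<close> is not unique, which allows passing to a common denominator.\<close>

definition laurent :: "nat \<Rightarrow> 'a::field poly \<Rightarrow> 'a poly fract" where
  "laurent N p = Fraction_Field.Fract p (monom 1 N)"

lemma laurent_eq_iff: "laurent N p = laurent M q \<longleftrightarrow> p * monom 1 M = q * monom 1 N"
  unfolding laurent_def by (simp add: eq_fract)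

lemma laurent_mult: "laurent N p * laurent M q = laurent (N + M) (p * q)"
  unfolding laurent_def by (simp add: mult_monom)

lemma laurent_add: "laurent N p + laurent M q = laurent (N + M) (p * monom 1 M + q * monom 1 N)"
  unfolding laurent_def by (simp add: mult_monom)

lemma laurent_uminus: "- laurent N p = laurent N (- p)"
  unfolding laurent_def by simp

lemma laurent_shift: "laurent (N + k) (p * monom 1 k) = laurent N p"
  unfolding laurent_eq_iff by (simp add: mult_monom mult.assoc add.commute)

lemma laurent_add_same: "laurent N p + laurent N q = laurent N (p + q)"
  using laurent_shift[of N N "p + q"] by (simp add: laurent_add algebra_simps)

lemma laurent_diff_same: "laurent N p - laurent N q = laurent N (p - q)"
  using laurent_add_same[of N p "- q"] by (simp add: laurent_uminus[symmetric])

lemma laurent_0 [simp]: "laurent N 0 = 0"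
  unfolding laurent_def by (simp add: Zero_fract_def eq_fract)

lemma laurent_0_1 [simp]: "laurent 0 1 = 1"
  unfolding laurent_def by (simp add: One_fract_def)

lemma laurent_sum: "(\<Sum>i\<in>I. laurent N (p i)) = laurent N (\<Sum>i\<in>I. p i)"
  by (induction I rule: infinite_finite_induct) (simp_all add: laurent_add_same)

lemma const_fn_eq: "const_fn c = [:laurent 0 [:c:]:]"
  by (simp add: const_fn_def laurent_def)

lemma x_fn_eq: "x_fn = [:laurent 0 [:0, 1:]:]"
  by (simp add: x_fn_def laurent_def)

lemma x_inv_eq: "x_inv = [:laurent 1 1:]"
  by (simp add: x_inv_def laurent_def monom_altdef)

lemma x_inv_power: "x_inv ^ n = [:laurent n 1:]"
  by (induction n) (simp_all add: x_inv_eq laurent_mult pCons_one)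

lemma const_fn_0 [simp]: "const_fn 0 = 0"
  by (simp add: const_fn_eq)

lemma const_fn_1 [simp]: "const_fn 1 = 1"
  by (metis const_fn_eq laurent_0_1 one_pCons)

lemma const_fn_add: "const_fn (a + b) = const_fn a + const_fn b"
  by (simp add: const_fn_eq laurent_add_same)

lemma const_fn_mult: "const_fn (a * b) = const_fn a * const_fn b"
  by (simp add: const_fn_eq laurent_mult)

lemma const_fn_uminus: "const_fn (- a) = - const_fn a"
  by (simp add: const_fn_eq laurent_uminus)

lemma const_fn_diff: "const_fn (a - b) = const_fn a - const_fn b"
  using const_fn_add[of a "- b"] by (simp add: const_fn_uminus)

lemma const_fn_sum: "const_fn (\<Sum>i\<in>I. a i) = (\<Sum>i\<in>I. const_fn (a i))"
  by (induction I rule: infinite_finite_induct) (simp_all add: const_fn_add)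

lemma const_fn_power: "const_fn (a ^ n) = const_fn a ^ n"
  by (induction n) (simp_all add: const_fn_mult)

lemma subalgebra_0: "0 \<in> subalgebra const_fn S"
  using subalgebra.const[of const_fn 0] by simp

lemma subalgebra_1: "1 \<in> subalgebra const_fn S"
  using subalgebra.const[of const_fn 1] by simp

lemma subalgebra_power: "s \<in> subalgebra const_fn S \<Longrightarrow> s ^ n \<in> subalgebra const_fn S"
  by (induction n) (auto intro: subalgebra_1 subalgebra.mult)

lemma subalgebra_sum: "(\<And>i. i \<in> I \<Longrightarrow> s i \<in> subalgebra const_fn S) \<Longrightarrow> sum s I \<in> subalgebra const_fn S"
  by (induction I rule: infinite_finite_induct) (auto intro: subalgebra_0 subalgebra.add)

lemma polynomial_in_subalgebra:
  assumes "x_fn \<in> S"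
  shows "[:laurent 0 p:] \<in> subalgebra const_fn S"
proof (induction p)
  case (pCons a p)
  have "pCons a p = [:a:] + [:0, 1:] * p" by simp
  hence "[:laurent 0 (pCons a p):] = const_fn a + x_fn * [:laurent 0 p:]"
    by (simp only: const_fn_eq x_fn_eq) (simp add: laurent_mult laurent_add_same)
  thus ?case using pCons.IH assms by (simp only: subalgebra.intros)
qed (simp add: subalgebra_0)

lemma inverse_polynomial_in_subalgebra:
  assumes "x_inv \<in> S" "degree p \<le> N"
  shows "[:laurent N p:] \<in> subalgebra const_fn S"
proof -
  have "laurent N p = laurent N (\<Sum>i\<le>N. monom (poly.coeff p i) i)"
    using poly_as_sum_of_monoms'[OF assms(2)] by simp
  also have "\<dots> = (\<Sum>i\<le>N. laurent N (monom (poly.coeff p i) i))" by (simp add: laurent_sum)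
  also have "\<dots> = (\<Sum>i\<le>N. laurent (N - i) [:poly.coeff p i:])"
    by (intro sum.cong refl) (simp add: laurent_eq_iff mult_monom monom_0[symmetric])
  finally have "[:laurent N p:] = (\<Sum>i\<le>N. [:laurent (N - i) [:poly.coeff p i:]:])"
    by (simp add: sum_to_poly)
  also have "\<dots> = (\<Sum>i\<le>N. const_fn (poly.coeff p i) * x_inv ^ (N - i))"
    by (simp add: const_fn_eq x_inv_power laurent_mult)
  also have "\<dots> \<in> subalgebra const_fn S"
    using assms(1) by (intro subalgebra_sum subalgebra.mult subalgebra_power) (auto intro: subalgebra.intros)
  finally show ?thesis .
qed

lemma laurent_in_functions_XZ: "[:laurent N p:] \<in> functions_XZ"
proof -
  have "[:laurent N p:] = [:laurent 0 p:] * x_inv ^ N" by (simp add: x_inv_power laurent_mult)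
  also have "\<dots> \<in> functions_XZ" unfolding functions_XZ_def
    by (intro subalgebra.mult subalgebra_power polynomial_in_subalgebra subalgebra.gen) auto
  finally show ?thesis .
qed

lemma pCons_laurent_in_functions_XZ: "[:laurent N p, laurent M q:] \<in> functions_XZ"
proof -
  have "[:laurent N p, laurent M q:] = [:laurent N p:] + y_fn * [:laurent M q:]"
    by (simp add: y_fn_def)
  moreover have "y_fn \<in> functions_XZ" unfolding functions_XZ_def by (auto intro: subalgebra.gen)
  ultimately show ?thesis
    using laurent_in_functions_XZ unfolding functions_XZ_def
    by (metis subalgebra.add subalgebra.mult)
qed

section \<open>Normal forms modulo the equation of the curve\<close>

text \<open>The affine equation \<open>y^2 + h y - f\<close> over \<open>k(x)\<close>. Being monic
  of degree 2 in \<open>y\<close>, it reduces every function to the form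
  \<open>u + v y\<close>.\<close>

definition curve_poly :: "'a::field poly \<Rightarrow> 'a poly \<Rightarrow> 'a poly fract poly" where
  "curve_poly h f = [:- laurent 0 f, laurent 0 h, 1:]"

lemma curve_poly_in_functions_XZ: "curve_poly h f \<in> functions_XZ"
proof -
  have "curve_poly h f = [:laurent 0 (- f), laurent 0 h:] + y_fn * y_fn"
    by (simp add: curve_poly_def y_fn_def laurent_uminus)
  moreover have "y_fn \<in> functions_XZ" unfolding functions_XZ_def by (auto intro: subalgebra.gen)
  ultimately show ?thesis
    using pCons_laurent_in_functions_XZ unfolding functions_XZ_def
    by (metis subalgebra.add subalgebra.mult)
qed

text \<open>A nonzero multiple of a polynomial of degree 2 over a field has degree at least 2. This
  makes the normal form \<open>u + v y\<close> unique.\<close>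

lemma curve_poly_mult_linear:
  assumes "curve_poly h f * c = [:u, v:]"
  shows "c = 0"
proof (rule ccontr)
  assume "c \<noteq> 0"
  moreover have "curve_poly h f \<noteq> 0" "degree (curve_poly h f) = 2" by (auto simp: curve_poly_def)
  ultimately have "degree (curve_poly h f * c) \<ge> 2" by (simp add: degree_mult_eq)
  thus False unfolding assms by (simp split: if_splits)
qed

text \<open>Functions \<open>u + v t y\<close> modulo the equation, for a ring \<open>R\<close> of
  functions of \<open>x\<close>. With \<open>t = 1\<close> this covers the chart
  \<open>Z \<noteq> 0\<close> and the overlap, with \<open>t = x^(-(g+1))\<close> the chart
  \<open>X \<noteq> 0\<close>.\<close>

definition normal_forms ::
    "'a::field poly \<Rightarrow> 'a poly \<Rightarrow> 'a poly fract set \<Rightarrow> 'a poly fract \<Rightarrow> 'a poly fract poly set" where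
  "normal_forms h f R t =
     {[:u, v * t:] + curve_poly h f * c |u v c. u \<in> R \<and> v \<in> R \<and> c \<in> functions_XZ}"

text \<open>Modulo the equation, \<open>(t y)^2 = f t^2 - h t (t y)\<close>, and both coefficients
  on the right lie in \<open>R\<close>.\<close>

lemma normal_forms_mult:
  assumes add: "\<And>u v. u \<in> R \<Longrightarrow> v \<in> R \<Longrightarrow> u + v \<in> R"
    and minus: "\<And>u v. u \<in> R \<Longrightarrow> v \<in> R \<Longrightarrow> u - v \<in> R"
    and mult: "\<And>u v. u \<in> R \<Longrightarrow> v \<in> R \<Longrightarrow> u * v \<in> R"
    and h: "laurent 0 h * t \<in> R" and f: "laurent 0 f * t ^ 2 \<in> R"
    and RL: "R \<subseteq> range (case_prod laurent)" and t: "t = laurent n 1"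
    and s: "s \<in> normal_forms h f R t" "s' \<in> normal_forms h f R t"
  shows "s * s' \<in> normal_forms h f R t"
proof -
  let ?F = "curve_poly h f"
  obtain u v c where s1: "s = [:u, v * t:] + ?F * c" and uv: "u \<in> R" "v \<in> R" and c: "c \<in> functions_XZ"
    using s(1) by (auto simp: normal_forms_def)
  obtain u' v' c' where s2: "s' = [:u', v' * t:] + ?F * c'" and uv': "u' \<in> R" "v' \<in> R" and c': "c' \<in> functions_XZ"
    using s(2) by (auto simp: normal_forms_def)
  \<comment> \<open>The total multiple of the equation: one term from reducing \<open>y^2\<close>,
    the others from the cross terms.\<close>
  define d where "d = [:v * v' * t ^ 2:] + [:u, v * t:] * c' + c * [:u', v' * t:] + ?F * c * c'"
  have "[:u, v * t:] * [:u', v' * t:] =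
      [:u * u' + laurent 0 f * t ^ 2 * (v * v'), (u * v' + u' * v - laurent 0 h * t * (v * v')) * t:]
      + ?F * [:v * v' * t ^ 2:]"
    by (simp add: curve_poly_def algebra_simps power2_eq_square)
  hence "s * s' = [:u * u' + laurent 0 f * t ^ 2 * (v * v'), (u * v' + u' * v - laurent 0 h * t * (v * v')) * t:] + ?F * d"
    unfolding s1 s2 d_def by (simp only: ring_distribs mult.assoc mult.left_commute mult.commute add.assoc add.left_commute add.commute)
  moreover have "d \<in> functions_XZ"
  proof -
    have L: "\<And>w. w \<in> R \<Longrightarrow> \<exists>N p. w = laurent N p" using RL by (force dest: subsetD)
    have C: "[:w, w' * t:] \<in> functions_XZ" if "w \<in> R" "w' \<in> R" for w w'
      using L[OF that(1)] L[OF that(2)] pCons_laurent_in_functions_XZ by (force simp: t laurent_mult)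
    have F: "?F \<in> functions_XZ" by (rule curve_poly_in_functions_XZ)
    have "[:v * v' * t ^ 2:] \<in> functions_XZ"
      using L[OF uv(2)] L[OF uv'(2)] laurent_in_functions_XZ
      by (force simp: t laurent_mult power2_eq_square)
    thus ?thesis using C[OF uv] C[OF uv'] F c c' unfolding d_def functions_XZ_def
      by (intro subalgebra.add subalgebra.mult)
  qed
  ultimately show ?thesis
    using uv uv' h f unfolding normal_forms_def by (blast intro: add minus mult)
qed

text \<open>Modulo the equation, \<open>R + R t y\<close> contains the constants and generators and
  is closed under sums and products.\<close>

lemma subalgebra_subset_normal_forms:
  assumes const: "\<And>a. laurent 0 [:a:] \<in> R"
    and add: "\<And>u v. u \<in> R \<Longrightarrow> v \<in> R \<Longrightarrow> u + v \<in> R"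
    and mult: "\<And>u v. u \<in> R \<Longrightarrow> v \<in> R \<Longrightarrow> u * v \<in> R"
    and h: "laurent 0 h * t \<in> R" and f: "laurent 0 f * t ^ 2 \<in> R"
    and RL: "R \<subseteq> range (case_prod laurent)" and t: "t = laurent n 1"
    and S: "\<And>s. s \<in> S \<Longrightarrow> \<exists>u\<in>R. \<exists>v\<in>R. s = [:u, v * t:]"
  shows "subalgebra const_fn S \<subseteq> normal_forms h f R t"
proof
  have in_nf: "[:u, v * t:] \<in> normal_forms h f R t" if "u \<in> R" "v \<in> R" for u v
    unfolding normal_forms_def using that subalgebra_0 functions_XZ_def by force
  have zero: "0 \<in> R" using const[of 0] by simp
  have minus: "u - v \<in> R" if "u \<in> R" "v \<in> R" for u v
  proof -
    have "laurent 0 [:- 1:] = (- 1 :: 'a poly fract)"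
      by (metis laurent_0_1 laurent_uminus minus_pCons minus_zero one_pCons)
    thus ?thesis using add[OF that(1) mult[OF const[of "-1"] that(2)]] by simp
  qed
  fix s assume "s \<in> subalgebra const_fn S"
  thus "s \<in> normal_forms h f R t"
  proof induction
    case (const a)
    show ?case using in_nf[OF assms(1) zero, of a] by (simp add: const_fn_eq)
  next
    case (gen s)
    thus ?case using S in_nf by blast
  next
    case (add s s')
    then obtain u v c u' v' c' where "s = [:u, v * t:] + curve_poly h f * c" "u \<in> R" "v \<in> R" "c \<in> functions_XZ"
       "s' = [:u', v' * t:] + curve_poly h f * c'" "u' \<in> R" "v' \<in> R" "c' \<in> functions_XZ"
      by (auto simp: normal_forms_def)
    hence "s + s' = [:u + u', (v + v') * t:] + curve_poly h f * (c + c')"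
      "u + u' \<in> R" "v + v' \<in> R" "c + c' \<in> functions_XZ"
      using assms(2) by (auto simp: algebra_simps functions_XZ_def intro: subalgebra.add)
    thus ?case unfolding normal_forms_def by blast
  next
    case (mult s s')
    show ?case
      by (rule normal_forms_mult[OF assms(2) minus assms(3) h f RL t mult.IH])
  qed
qed

lemma functions_XZ_normal_form:
  assumes "s \<in> functions_XZ"
  obtains N p M q c where "c \<in> functions_XZ" "s = [:laurent N p, laurent M q:] + curve_poly h f * c"
proof -
  have I: "laurent N p \<in> range (case_prod laurent)" for N and p :: "'a poly"
      by (rule range_eqI[of _ _ "(N, p)"]) simp
  have "functions_XZ \<subseteq> normal_forms h f (range (case_prod laurent)) (laurent 0 1)"
    unfolding functions_XZ_def
  proof (rule subalgebra_subset_normal_forms[where n = 0])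
    fix s :: "'a poly fract poly" assume "s \<in> {x_fn, x_inv, y_fn}"
    hence "s = [:laurent 0 [:0, 1:], laurent 0 0 * laurent 0 1:] \<or> s = [:laurent 1 1, laurent 0 0 * laurent 0 1:] \<or>
        s = [:laurent 0 0, laurent 0 1 * laurent 0 1:]"
      by (auto simp: x_fn_eq x_inv_eq y_fn_def)
    thus "\<exists>u\<in>range (case_prod laurent). \<exists>v\<in>range (case_prod laurent). s = [:u, v * laurent 0 1:]"
      using I by blast
  qed (auto simp: laurent_add laurent_mult power2_eq_square intro!: I)
  thus thesis using assms that by (fastforce simp: normal_forms_def)
qed

lemma functions_Z_normal_form:
  assumes "s \<in> functions_Z"
  obtains p q c where "s = [:laurent 0 p, laurent 0 q:] + curve_poly h f * c"
proof -
  have "functions_Z \<subseteq> normal_forms h f (range (laurent 0)) (laurent 0 1)"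
    unfolding functions_Z_def
  proof (rule subalgebra_subset_normal_forms[where n = 0])
    fix s :: "'a poly fract poly" assume "s \<in> {x_fn, y_fn}"
    hence "s = [:laurent 0 [:0, 1:], laurent 0 0 * laurent 0 1:] \<or> s = [:laurent 0 0, laurent 0 1 * laurent 0 1:]"
      by (auto simp: x_fn_eq y_fn_def)
    thus "\<exists>u\<in>range (laurent 0). \<exists>v\<in>range (laurent 0). s = [:u, v * laurent 0 1:]"
      by blast
  qed (auto simp: laurent_add laurent_mult power2_eq_square)
  thus thesis using assms that by (fastforce simp: normal_forms_def)
qed

text \<open>Here \<open>R\<close> is \<open>k[1/x]\<close>, written as fractions
  \<open>p / x^N\<close> with \<open>degree p \<le> N\<close>. The degree bounds put
  \<open>h / x^(g+1)\<close> and \<open>f / x^(2g+2)\<close> into \<open>R\<close>, so the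
  coefficient of \<open>y\<close> has only exponents up to \<open>-(g+1)\<close>.\<close>

lemma functions_X_normal_form:
  assumes "s \<in> functions_X g" and h: "degree h \<le> g + 1" and f: "degree f \<le> 2 * g + 2"
  obtains N p M q c where "degree q \<le> M" "s = [:laurent N p, laurent (M + (g + 1)) q:] + curve_poly h f * c"
proof -
  let ?R = "{laurent N p |N p. degree p \<le> N}"
  let ?t = "laurent (g + 1) 1"
  have I: "laurent N p \<in> ?R" if "degree p \<le> N" for N and p :: "'a poly" using that by blast
  have "functions_X g \<subseteq> normal_forms h f ?R ?t"
    unfolding functions_X_def
  proof (rule subalgebra_subset_normal_forms[where n = "g + 1"])
    fix s :: "'a poly fract poly" assume "s \<in> {x_inv, y_fn * x_inv ^ (g + 1)}"
    hence "s = [:laurent 1 1, laurent 0 0 * ?t:] \<or> s = [:laurent 0 0, laurent 0 1 * ?t:]"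
      unfolding x_inv_power by (auto simp: x_inv_eq y_fn_def)
    moreover have "laurent 0 (0 :: 'a poly) \<in> ?R" "laurent 0 (1 :: 'a poly) \<in> ?R" "laurent 1 (1 :: 'a poly) \<in> ?R"
      by (rule I, simp)+
    ultimately show "\<exists>u\<in>?R. \<exists>v\<in>?R. s = [:u, v * ?t:]"
      by blast
  next
    fix u v :: "'a poly fract" assume "u \<in> ?R" "v \<in> ?R"
    then obtain N p M q where *: "u = laurent N p" "v = laurent M q" "degree p \<le> N" "degree q \<le> M" by blast
    have "degree (p * monom 1 M) \<le> N + M" "degree (q * monom 1 N) \<le> N + M"
      using *(3,4) degree_mult_le[of p "monom 1 M"] degree_mult_le[of q "monom 1 N"]
        degree_monom_le[of "1::'a" M] degree_monom_le[of "1::'a" N] by simp_all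
    thus "u + v \<in> ?R" unfolding * laurent_add by (intro I degree_add_le)
    show "u * v \<in> ?R" unfolding * laurent_mult using *(3,4) degree_mult_le[of p q] by (intro I) linarith
  next
    show "laurent 0 h * ?t \<in> ?R" "laurent 0 f * ?t ^ 2 \<in> ?R"
      using I[of h "g + 1"] I[of f "2 * g + 2"] h f by (auto simp: laurent_mult power2_eq_square mult_2)
    show "laurent 0 [:a:] \<in> ?R" for a :: 'a by (rule I) simp
  qed auto
  hence "s \<in> normal_forms h f ?R ?t" using assms(1) by blast
  then obtain u v c where s: "s = [:u, v * ?t:] + curve_poly h f * c" "u \<in> ?R" "v \<in> ?R"
    unfolding normal_forms_def by blast
  then obtain N p M q where "u = laurent N p" "v = laurent M q" "degree q \<le> M" by blast
  thus thesis using that s by (simp add: laurent_mult)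
qed

section \<open>The Frobenius on the cohomology\<close>

lemma coeff_mult_monom:
  "poly.coeff (p * monom c n) m = (if m < n then 0 else poly.coeff p (m - n) * c)"
  for p :: "'a::comm_semiring_1 poly"
  using coeff_monom_mult[of c n p m] by (simp add: mult.commute)

text \<open>A polynomial has no negative exponents, and the last summand only exponents up to
  \<open>-(g+1)\<close>. Hence \<open>x^(-(i+1))\<close>, whose coefficient is stored in
  \<open>q\<close> at \<open>N - Suc i\<close>, does not occur.\<close>

lemma pole_coeffs_of_sum_eq_0:
  assumes eq: "laurent N q = laurent 0 r + laurent (M + (g + 1)) t"
    and deg: "degree t \<le> M" and i: "i < g" "i < N"
  shows "poly.coeff q (N - Suc i) = 0"
proof -
  let ?K = "M + (g + 1)"
  have "laurent N q = laurent ?K (r * monom 1 ?K + t)"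
    using eq by (simp add: laurent_add flip: one_pCons monom_0)
  hence "q * monom 1 ?K = (r * monom 1 ?K + t) * monom 1 N"
    by (simp only: laurent_eq_iff)
  moreover have "N - Suc i + ?K = ?K - Suc i + N" using i by simp
  ultimately have "poly.coeff (q * monom 1 ?K) (N - Suc i + ?K) = poly.coeff ((r * monom 1 ?K + t) * monom 1 N) (?K - Suc i + N)"
    by metis
  hence "poly.coeff q (N - Suc i) = poly.coeff (r * monom 1 ?K + t) (?K - Suc i)"
    by (simp add: coeff_mult_monom)
  also have "\<dots> = 0"
    using i deg by (simp add: coeff_mult_monom coeff_eq_0)
  finally show ?thesis .
qed

lemma affine_eq_eq:
  assumes "map_poly (\<lambda>c. poly c 1) H1 = h" "map_poly (\<lambda>c. poly c 1) H0 = f"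
  shows "affine_eq (H1 :: 'a::field poly poly) H0 = curve_poly h f"
proof -
  have 1: "poly (map_poly const_fn c) 1 = const_fn (poly c 1)" for c :: "'a poly"
    by (induction c) (simp_all add: map_poly_pCons const_fn_add const_fn_mult)
  have 2: "eval2 const_fn H x_fn 1 = [:laurent 0 (map_poly (\<lambda>c. poly c 1) H):]" for H :: "'a poly poly"
    unfolding eval2_def 1
  proof (induction H)
    case (pCons a H)
    thus ?case
      by (simp add: map_poly_pCons const_fn_eq x_fn_eq laurent_mult laurent_add_same)
  qed simp
  have "map_poly (\<lambda>c. poly c 1) (- H0) = - f"
    using assms(2) by (intro poly_eqI) (auto simp: coeff_map_poly)
  hence 3: "eval2 const_fn (- H0) x_fn 1 = - [:laurent 0 f:]" unfolding 2 by (simp add: laurent_uminus)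
  have 4: "eval2 const_fn H1 x_fn 1 = [:laurent 0 h:]" "eval2 const_fn (1 :: 'a poly poly) x_fn 1 = 1"
    using assms(1) unfolding 2 by (simp_all add: map_poly_1 pCons_one)
  have 0: "eval2 const_fn (0 :: 'a poly poly) x_fn 1 = 0" unfolding 2 by simp
  show ?thesis
    unfolding affine_eq_def eval3_def curve_eq_def
    by (simp add: map_poly_pCons 0 3 4 curve_poly_def y_fn_def)
qed

section \<open>The coboundaries as a subspace stable under Frobenius\<close>

lemma coboundaries_add:
  assumes "s \<in> coboundaries g H1 H0" "t \<in> coboundaries g H1 H0"
  shows "s + t \<in> coboundaries g H1 H0"
proof -
  obtain a b c a' b' c' where "s = a + b + affine_eq H1 H0 * c" "t = a' + b' + affine_eq H1 H0 * c'"
    and *: "a \<in> functions_Z" "b \<in> functions_X g" "c \<in> functions_XZ" "a' \<in> functions_Z" "b' \<in> functions_X g" "c' \<in> functions_XZ"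
    using assms unfolding coboundaries_def by blast
  hence "s + t = (a + a') + (b + b') + affine_eq H1 H0 * (c + c')" by (simp add: algebra_simps)
  thus ?thesis using * subalgebra.add unfolding coboundaries_def functions_Z_def functions_X_def functions_XZ_def by blast
qed

lemma coboundaries_const_mult:
  assumes "s \<in> coboundaries g H1 H0"
  shows "const_fn k * s \<in> coboundaries g H1 H0"
proof -
  obtain a b c where "s = a + b + affine_eq H1 H0 * c"
    and *: "a \<in> functions_Z" "b \<in> functions_X g" "c \<in> functions_XZ"
    using assms unfolding coboundaries_def by blast
  hence "const_fn k * s = const_fn k * a + const_fn k * b + affine_eq H1 H0 * (const_fn k * c)" by (simp add: algebra_simps)
  thus ?thesis using * subalgebra.mult[OF subalgebra.const[of const_fn k]]
    unfolding coboundaries_def functions_Z_def functions_X_def functions_XZ_def by blast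
qed

lemma coboundaries_uminus: "s \<in> coboundaries g H1 H0 \<Longrightarrow> - s \<in> coboundaries g H1 H0"
  using coboundaries_const_mult[of s g H1 H0 "- 1"] by (simp add: const_fn_uminus)

lemma coboundaries_diff:
  "s \<in> coboundaries g H1 H0 \<Longrightarrow> t \<in> coboundaries g H1 H0 \<Longrightarrow> s - t \<in> coboundaries g H1 H0"
  using coboundaries_add[OF _ coboundaries_uminus] by fastforce

lemma coboundaries_0: "0 \<in> coboundaries g H1 H0"
  unfolding coboundaries_def functions_Z_def functions_X_def functions_XZ_def
  using subalgebra_0 by force

lemma coboundaries_sum:
  "(\<And>i. i \<in> I \<Longrightarrow> s i \<in> coboundaries g H1 H0) \<Longrightarrow> sum s I \<in> coboundaries g H1 H0"
  by (induction I rule: infinite_finite_induct) (auto intro: coboundaries_0 coboundaries_add)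

lemma minus_eq_char_2:
  assumes "CHAR('a::ring_1) = 2"
  shows "- a = (a :: 'a)"
proof -
  have "(2 :: 'a) = 0" using of_nat_CHAR[where 'a = 'a] assms by simp
  hence "a + a = 0" using mult_2[of a] by simp
  thus ?thesis by (rule minus_unique)
qed

lemma square_add_char_2:
  assumes "CHAR('a::field) = 2"
  shows "(s + t) ^ 2 = s ^ 2 + (t :: 'a poly fract poly) ^ 2"
proof -
  have "(2 :: 'a) = 0" using of_nat_CHAR[where 'a = 'a] assms by simp
  moreover have "(2 :: 'a poly fract poly) = const_fn 2"
    using const_fn_add[of "1::'a" 1] by simp
  ultimately have "(2 :: 'a poly fract poly) = 0" by simp
  thus ?thesis by (simp add: power2_sum)
qed

text \<open>In characteristic 2 squaring is additive; it preserves both subalgebras and the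
  multiples of the equation. So Frobenius descends to the quotient.\<close>

lemma coboundaries_square:
  assumes "CHAR('a) = 2" and s: "s \<in> coboundaries g H1 (H0 :: 'a::field poly poly)"
  shows "s ^ 2 \<in> coboundaries g H1 H0"
proof -
  let ?F = "affine_eq H1 H0"
  obtain a b c where s: "s = a + b + ?F * c" and *: "a \<in> functions_Z" "b \<in> functions_X g" "c \<in> functions_XZ"
    using s unfolding coboundaries_def by blast
  have F: "?F \<in> functions_XZ"
    unfolding affine_eq_eq[OF refl refl] by (rule curve_poly_in_functions_XZ)
  have "s ^ 2 = a ^ 2 + b ^ 2 + ?F * (?F * c ^ 2)"
    unfolding s square_add_char_2[OF assms(1)] by (simp add: power_mult_distrib power2_eq_square)
  thus ?thesis using * F unfolding coboundaries_def functions_Z_def functions_X_def functions_XZ_def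
    by (blast intro: subalgebra_power subalgebra.mult)
qed

text \<open>In characteristic 2, the matrix of Frobenius in the basis
  \<open>y x^(-1), ..., y x^(-g)\<close>. With indices from 0 the entry is
  \<open>h_(2(j+1)-(i+1))\<close>; the guard makes coefficients of negative index zero.\<close>

definition frobenius_mat :: "nat \<Rightarrow> 'a::zero poly \<Rightarrow> 'a mat" where
  "frobenius_mat g h = mat g g (\<lambda>(i, j). if i \<le> 2 * j + 1 then poly.coeff h (2 * j + 1 - i) else 0)"

lemma frobenius_mat_carrier: "frobenius_mat g h \<in> carrier_mat g g"
  and dim_frobenius_mat [simp]: "dim_row (frobenius_mat g h) = g" "dim_col (frobenius_mat g h) = g"
  by (simp_all add: frobenius_mat_def)

section \<open>Coordinates on the cohomology: the coefficients of \<open>x^(-1), ..., x^(-g)\<close>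
  at \<open>y\<close>\<close>

context
  fixes g :: nat and H1 H0 :: "'a::field poly poly" and h f :: "'a poly"
  assumes h: "map_poly (\<lambda>c. poly c 1) H1 = h" and f: "map_poly (\<lambda>c. poly c 1) H0 = f"
    and deg_h: "degree h \<le> g + 1" and deg_f: "degree f \<le> 2 * g + 2"
begin

text \<open>Subtracting the normal forms of the two chart components leaves a multiple of the
  equation that is linear in \<open>y\<close>, hence 0. The coefficients of \<open>y\<close> can
  then be compared.\<close>

lemma coboundary_pole_coeffs:
  assumes "[:laurent N p, laurent K q:] + curve_poly h f * c \<in> coboundaries g H1 H0"
    and "i < g" "i < K"
  shows "poly.coeff q (K - Suc i) = 0"
proof -
  let ?F = "curve_poly h f"
  obtain a b d where eq: "[:laurent N p, laurent K q:] + ?F * c = a + b + ?F * d"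
    and ab: "a \<in> functions_Z" "b \<in> functions_X g"
    using assms(1) unfolding coboundaries_def affine_eq_eq[OF h f] by blast
  obtain p1 q1 c1 where a: "a = [:laurent 0 p1, laurent 0 q1:] + ?F * c1"
    using functions_Z_normal_form[OF ab(1)] by metis
  obtain N2 p2 M q2 c2 where b: "b = [:laurent N2 p2, laurent (M + (g + 1)) q2:] + ?F * c2" "degree q2 \<le> M"
    using functions_X_normal_form[OF ab(2) deg_h deg_f] by metis
  let ?u = "laurent N p - laurent 0 p1 - laurent N2 p2"
    and ?v = "laurent K q - laurent 0 q1 - laurent (M + (g + 1)) q2"
  have "[:?u, ?v:] = [:laurent N p, laurent K q:] - [:laurent 0 p1, laurent 0 q1:] - [:laurent N2 p2, laurent (M + (g + 1)) q2:]"
    by simp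
  also have "\<dots> = ?F * (d + c1 + c2 - c)"
    using eq unfolding a b by (simp only: algebra_simps)
  finally have *: "?F * (d + c1 + c2 - c) = [:?u, ?v:]" ..
  hence "[:?u, ?v:] = 0" using curve_poly_mult_linear[OF *] by simp
  hence "?v = 0" by simp
  hence "laurent K q = laurent 0 q1 + laurent (M + (g + 1)) q2" by (metis diff_diff_eq right_minus_eq)
  thus ?thesis using pole_coeffs_of_sum_eq_0[OF _ b(2)] assms by blast
qed

text \<open>Nonnegative exponents belong to the chart \<open>Z \<noteq> 0\<close>. If the
  coefficient of \<open>y\<close> lacks the exponents from \<open>-g\<close> to \<open>-1\<close>,
  its other negative ones are at most \<open>-(g+1)\<close> and belong to the chart
  \<open>X \<noteq> 0\<close>.\<close>

lemma coboundaryI: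
  assumes c: "c \<in> functions_XZ"
    and z: "\<And>i. i < g \<Longrightarrow> i < K \<Longrightarrow> poly.coeff q (K - Suc i) = 0"
  shows "[:laurent N p, laurent K q:] + curve_poly h f * c \<in> coboundaries g H1 H0"
proof -
  \<comment> \<open>Over the denominator \<open>x^L\<close> the exponents from \<open>-g\<close> to
    \<open>-1\<close> sit strictly between the indices \<open>K\<close> and \<open>L\<close>.
    Cutting \<open>q'\<close> off at \<open>L\<close> therefore leaves degree at most
    \<open>K\<close>.\<close>
  define q' where "q' = q * monom 1 (g + 1)"
  define L where "L = K + (g + 1)"
  have Lq: "laurent K q = laurent L q'" unfolding L_def q'_def laurent_shift ..
  have z': "poly.coeff q' n = 0" if "K < n" "n < L" for n
  proof (cases "g < n")
    case True
    have "poly.coeff q' n = poly.coeff q (n - (g + 1))"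
      using True unfolding q'_def by (simp add: coeff_mult_monom)
    also have "n - (g + 1) = K - Suc (L - Suc n)" using that True unfolding L_def by simp
    also have "poly.coeff q (K - Suc (L - Suc n)) = 0" using that True unfolding L_def by (intro z) auto
    finally show ?thesis .
  next
    case False
    thus ?thesis unfolding q'_def by (simp add: coeff_mult_monom)
  qed
  define a where "a = [:laurent 0 (poly_shift N p):] + y_fn * [:laurent 0 (poly_shift L q'):]"
  define b where "b = [:laurent N (poly_cutoff N p):] + y_fn * x_inv ^ (g + 1) * [:laurent K (poly_cutoff L q'):]"
  have split: "laurent n r = laurent 0 (poly_shift n r) + laurent n (poly_cutoff n r)" for n and r :: "'a poly"
  proof -
    have "r = poly_cutoff n r + monom 1 n * poly_shift n r"
      by (intro poly_eqI) (simp add: coeff_poly_cutoff coeff_poly_shift coeff_monom_mult)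
    thus ?thesis
      using laurent_shift[of 0 n "poly_shift n r"] laurent_add_same[of n "poly_shift n r * monom 1 n" "poly_cutoff n r"]
      by (simp add: mult.commute add.commute)
  qed
  have ab: "[:laurent N p, laurent K q:] = a + b"
    unfolding a_def b_def x_inv_power Lq split[of N p] split[of L q']
    by (simp add: y_fn_def laurent_mult L_def add.commute)
  have "a \<in> functions_Z"
    unfolding a_def functions_Z_def
    by (intro subalgebra.add subalgebra.mult polynomial_in_subalgebra subalgebra.gen) auto
  moreover have "b \<in> functions_X g"
  proof -
    have "degree (poly_cutoff N p) \<le> N"
      by (rule degree_le) (simp add: coeff_poly_cutoff)
    moreover have "degree (poly_cutoff L q') \<le> K"
      by (rule degree_le) (use z' in \<open>auto simp: coeff_poly_cutoff\<close>)
    ultimately have "[:laurent N (poly_cutoff N p):] \<in> functions_X g" "[:laurent K (poly_cutoff L q'):] \<in> functions_X g"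
      unfolding functions_X_def by (auto intro: inverse_polynomial_in_subalgebra)
    moreover have "y_fn * x_inv ^ (g + 1) \<in> functions_X g"
      unfolding functions_X_def by (rule subalgebra.gen) simp
    ultimately show ?thesis unfolding b_def functions_X_def by (metis subalgebra.add subalgebra.mult)
  qed
  ultimately show ?thesis using c unfolding ab coboundaries_def affine_eq_eq[OF h f] by blast
qed

text \<open>\<open>k i\<close> is the coordinate of the class of \<open>s\<close> along
  \<open>y x^(-(i+1))\<close>; only the values below \<open>g\<close> are determined.\<close>

definition has_class :: "'a poly fract poly \<Rightarrow> (nat \<Rightarrow> 'a) \<Rightarrow> bool" where
  "has_class s k \<longleftrightarrow> s - (\<Sum>i<g. const_fn (k i) * [:0, laurent (Suc i) 1:]) \<in> coboundaries g H1 H0"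

lemma class_sum_eq:
  fixes k :: "nat \<Rightarrow> 'a"
  shows "(\<Sum>i<g. const_fn (k i) * [:0, laurent (Suc i) 1:]) = [:0, laurent g (\<Sum>i<g. monom (k i) (g - Suc i)):]"
proof -
  have "const_fn (k i) * [:0, laurent (Suc i) 1:] = [:0, laurent g (monom (k i) (g - Suc i)):]" if "i < g" for i
    using that by (simp add: const_fn_eq laurent_mult laurent_eq_iff mult_monom flip: monom_0)
  hence "(\<Sum>i<g. const_fn (k i) * [:0, laurent (Suc i) 1:]) = (\<Sum>i<g. [:0, laurent g (monom (k i) (g - Suc i)):])"
    by (intro sum.cong) auto
  also have "\<dots> = [:0, \<Sum>i<g. laurent g (monom (k i) (g - Suc i)):]"
  proof -
    have "(\<Sum>i\<in>I. [:0, w i:]) = [:0, \<Sum>i\<in>I. w i:]" for I :: "nat set" and w :: "nat \<Rightarrow> 'a poly fract"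
      by (induction I rule: infinite_finite_induct) simp_all
    thus ?thesis .
  qed
  finally show ?thesis by (simp add: laurent_sum)
qed

lemma coeff_class_sum:
  assumes "i < g"
  shows "poly.coeff (\<Sum>i<g. monom (k i) (g - Suc i)) (g - Suc i) = k i"
proof -
  have "poly.coeff (\<Sum>i<g. monom (k i) (g - Suc i)) (g - Suc i) = (\<Sum>j<g. if j = i then k j else 0)"
    unfolding coeff_sum using assms by (intro sum.cong) auto
  thus ?thesis using assms by simp
qed

text \<open>The difference to the combination with these coordinates has no exponents from
  \<open>-g\<close> to \<open>-1\<close> at \<open>y\<close>. An index \<open>i \<ge> K\<close>
  stands for an exponent below \<open>-K\<close>, where the coefficient is 0.\<close>

lemma has_class_normal_form:
  assumes "c \<in> functions_XZ"
  shows "has_class ([:laurent N p, laurent K q:] + curve_poly h f * c)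
     (\<lambda>i. if i < K then poly.coeff q (K - Suc i) else 0)"
proof -
  define k where "k = (\<lambda>i. if i < K then poly.coeff q (K - Suc i) else 0)"
  define S where "S = (\<Sum>i<g. monom (k i) (g - Suc i))"
  have "[:laurent N p, laurent K q:] + curve_poly h f * c - [:0, laurent g S:]
      = [:laurent N p, laurent (K + g) (q * monom 1 g - S * monom 1 K):] + curve_poly h f * c"
    using laurent_shift[of K g q] laurent_shift[of g K S]
    by (simp add: laurent_diff_same[symmetric] add.commute)
  also have "\<dots> \<in> coboundaries g H1 H0"
  proof (rule coboundaryI[OF assms])
    fix i assume i: "i < g" "i < K + g"
    have "poly.coeff (q * monom 1 g) (K + g - Suc i) = k i"
      using i by (auto simp: coeff_mult_monom k_def not_less)
    moreover have "poly.coeff (S * monom 1 K) (K + g - Suc i) = k i"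
      using i coeff_class_sum[OF i(1), of k] by (simp add: coeff_mult_monom S_def)
    ultimately show "poly.coeff (q * monom 1 g - S * monom 1 K) (K + g - Suc i) = 0" by simp
  qed
  finally show ?thesis unfolding has_class_def class_sum_eq S_def k_def .
qed

lemma has_class_exists:
  assumes "s \<in> functions_XZ"
  obtains k where "has_class s k"
proof -
  obtain N p M q c where "c \<in> functions_XZ" "s = [:laurent N p, laurent M q:] + curve_poly h f * c"
    using functions_XZ_normal_form[OF assms] by metis
  thus thesis using has_class_normal_form that by blast
qed

lemma class_sum_coboundaryD:
  assumes "(\<Sum>i<g. const_fn (k i) * [:0, laurent (Suc i) 1:]) \<in> coboundaries g H1 H0" "i < g"
  shows "k i = 0"
proof -
  have "[:laurent 0 0, laurent g (\<Sum>i<g. monom (k i) (g - Suc i)):] + curve_poly h f * 0 \<in> coboundaries g H1 H0"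
    using assms(1) unfolding class_sum_eq by simp
  from coboundary_pole_coeffs[OF this assms(2) assms(2)] show ?thesis
    using coeff_class_sum[OF assms(2), of k] by simp
qed

lemma has_class_unique:
  assumes "has_class s k" "has_class s l" "i < g"
  shows "k i = l i"
proof -
  have "(\<Sum>i<g. const_fn (k i - l i) * [:0, laurent (Suc i) 1:]) \<in> coboundaries g H1 H0"
    using coboundaries_diff[OF assms(2,1)[unfolded has_class_def]]
    by (simp add: sum_subtractf[symmetric] const_fn_diff left_diff_distrib del: mult_pCons_right)
  thus ?thesis using class_sum_coboundaryD[of "\<lambda>i. k i - l i" i] assms(3) by simp
qed

lemma has_class_sum:
  assumes "\<And>j. j \<in> J \<Longrightarrow> has_class (s j) (k j)"
  shows "has_class (\<Sum>j\<in>J. const_fn (a j) * s j) (\<lambda>i. \<Sum>j\<in>J. a j * k j i)"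
proof -
  let ?e = "\<lambda>i. [:0, laurent (Suc i) 1:]"
  have "(\<Sum>j\<in>J. const_fn (a j) * (s j - (\<Sum>i<g. const_fn (k j i) * ?e i))) \<in> coboundaries g H1 H0"
    using assms unfolding has_class_def by (intro coboundaries_sum coboundaries_const_mult)
  also have "(\<Sum>j\<in>J. const_fn (a j) * (s j - (\<Sum>i<g. const_fn (k j i) * ?e i)))
     = (\<Sum>j\<in>J. const_fn (a j) * s j) - (\<Sum>j\<in>J. \<Sum>i<g. const_fn (a j * k j i) * ?e i)"
    by (simp add: sum_subtractf right_diff_distrib sum_distrib_left const_fn_mult mult.assoc del: mult_pCons_right)
  also have "(\<Sum>j\<in>J. \<Sum>i<g. const_fn (a j * k j i) * ?e i) = (\<Sum>i<g. const_fn (\<Sum>j\<in>J. a j * k j i) * ?e i)"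
    by (subst sum.swap) (simp add: const_fn_sum sum_distrib_right del: mult_pCons_right)
  finally show ?thesis unfolding has_class_def .
qed

lemma has_class_cong_coboundary:
  assumes "has_class s k" "t - s \<in> coboundaries g H1 H0"
  shows "has_class t k"
  using coboundaries_add[OF assms(2) assms(1)[unfolded has_class_def]] unfolding has_class_def by simp

lemma has_class_cong:
  assumes "has_class s k" "\<And>i. i < g \<Longrightarrow> k i = l i"
  shows "has_class s l"
  using assms unfolding has_class_def by (simp del: mult_pCons_right)

lemma has_class_0_iff: "has_class s (\<lambda>i. 0) \<longleftrightarrow> s \<in> coboundaries g H1 H0"
  by (simp add: has_class_def)

lemma has_class_basis:
  assumes "j < g"
  shows "has_class [:0, laurent (Suc j) 1:] (\<lambda>i. if i = j then 1 else 0)"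
proof -
  have "(\<Sum>i<g. const_fn (if i = j then 1 else 0) * [:0, laurent (Suc i) 1:])
      = (\<Sum>i<g. if i = j then [:0, laurent (Suc i) 1:] else (0 :: 'a poly fract poly))"
    by (intro sum.cong) auto
  also have "\<dots> = [:0, laurent (Suc j) 1:]" using assms by simp
  finally show ?thesis unfolding has_class_def by (simp add: coboundaries_0 del: mult_pCons_right)
qed

lemma cohomology_basis_monomials: "cohomology_basis g H1 H0 (\<lambda>i. [:0, laurent (Suc i) 1:])"
  unfolding cohomology_basis_def
proof (intro conjI allI impI ballI)
  show "[:0, laurent (Suc i) 1:] \<in> functions_XZ" for i
    using pCons_laurent_in_functions_XZ[of 0 0 "Suc i" 1] by simp
  show "\<exists>k. s - (\<Sum>i<g. const_fn (k i) * [:0, laurent (Suc i) 1:]) \<in> coboundaries g H1 H0"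
    if "s \<in> functions_XZ" for s
    using has_class_exists[OF that] unfolding has_class_def by metis
qed (use class_sum_coboundaryD in blast)

text \<open>Reducing \<open>y^2\<close> gives \<open>(f - h y) x^(-(2j+2))\<close>, and
  \<open>- h x^(-(2j+2))\<close> has the coefficient \<open>- h_(2j+1-i)\<close> at
  \<open>x^(-(i+1))\<close>.\<close>

lemma has_class_basis_square:
  "has_class ([:0, laurent (Suc j) 1:] ^ 2) (\<lambda>i. if i \<le> 2 * j + 1 then - poly.coeff h (2 * j + 1 - i) else 0)"
proof -
  have eq: "[:0, laurent (Suc j) 1:] ^ 2 =
      [:laurent (2 * j + 2) f, laurent (2 * j + 2) (- h):] + curve_poly h f * [:laurent (2 * j + 2) 1:]"
    by (simp add: curve_poly_def power2_eq_square laurent_mult laurent_uminus laurent_add_same mult_2)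
  have "has_class ([:0, laurent (Suc j) 1:] ^ 2)
      (\<lambda>i. if i < 2 * j + 2 then poly.coeff (- h) (2 * j + 2 - Suc i) else 0)"
    unfolding eq by (rule has_class_normal_form[OF laurent_in_functions_XZ])
  thus ?thesis by (rule has_class_cong) (simp add: less_Suc_eq_le)
qed

section \<open>Frobenius in coordinates and change of basis\<close>

context
  assumes char_2: "CHAR('a) = 2"
begin

text \<open>Frobenius is additive and squares scalars: coordinates are squared before the matrix is
  applied. The sign in \<open>has_class_basis_square\<close> disappears in characteristic 2.\<close>

lemma has_class_square:
  assumes "has_class s k"
  shows "has_class (s ^ 2) (\<lambda>i. \<Sum>j<g. k j ^ 2 * (frobenius_mat g h) $$ (i, j))"
proof -
  let ?e = "\<lambda>i. [:0, laurent (Suc i) 1:] :: 'a poly fract poly"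
  let ?S = "\<Sum>i<g. const_fn (k i) * ?e i"
  have sq_sum: "(sum w I) ^ 2 = (\<Sum>i\<in>I. w i ^ 2)" for I :: "nat set" and w :: "nat \<Rightarrow> 'a poly fract poly"
    by (induction I rule: infinite_finite_induct) (simp_all add: square_add_char_2[OF char_2])
  have "s ^ 2 = ((s - ?S) + ?S) ^ 2" by simp
  also have "\<dots> = (s - ?S) ^ 2 + ?S ^ 2" by (rule square_add_char_2[OF char_2])
  finally have eq: "s ^ 2 - ?S ^ 2 = (s - ?S) ^ 2" by (simp del: mult_pCons_right)
  have c1: "s ^ 2 - ?S ^ 2 \<in> coboundaries g H1 H0"
    unfolding eq by (rule coboundaries_square[OF char_2 assms[unfolded has_class_def]])
  have S2: "?S ^ 2 = (\<Sum>j<g. const_fn (k j ^ 2) * ?e j ^ 2)"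
    unfolding sq_sum const_fn_power power_mult_distrib ..
  have c2: "has_class (\<Sum>j<g. const_fn (k j ^ 2) * ?e j ^ 2)
      (\<lambda>i. \<Sum>j<g. k j ^ 2 * (if i \<le> 2 * j + 1 then - poly.coeff h (2 * j + 1 - i) else 0))"
    by (rule has_class_sum) (rule has_class_basis_square)
  from has_class_cong_coboundary[OF c2 c1[unfolded S2]]
  show ?thesis
    by (rule has_class_cong) (auto simp: frobenius_mat_def minus_eq_char_2[OF char_2] intro!: sum.cong)
qed

lemma hasse_witt_matrix_frobenius_mat: "hasse_witt_matrix g H1 H0 (frobenius_mat g h)"
  unfolding hasse_witt_matrix_def char_2
proof (intro conjI exI allI impI)
  fix j assume j: "j < g"
  have "has_class ([:0, laurent (Suc j) 1:] ^ 2) (\<lambda>i. \<Sum>l<g. (if l = j then 1 else 0) ^ 2 * (frobenius_mat g h) $$ (i, l))"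
    by (rule has_class_square[OF has_class_basis[OF j]])
  moreover have "(\<Sum>l<g. (if l = j then 1 else 0) ^ 2 * (frobenius_mat g h) $$ (i, l)) = (frobenius_mat g h) $$ (i, j)" for i
  proof -
    have "(\<Sum>l<g. (if l = j then 1 else 0) ^ 2 * (frobenius_mat g h) $$ (i, l)) = (\<Sum>l<g. if l = j then (frobenius_mat g h) $$ (i, l) else 0)"
      by (intro sum.cong) auto
    thus ?thesis using j by simp
  qed
  ultimately show "[:0, laurent (Suc j) 1:] ^ 2 - (\<Sum>i<g. const_fn ((frobenius_mat g h) $$ (i, j)) * [:0, laurent (Suc i) 1:])
      \<in> coboundaries g H1 H0"
    unfolding has_class_def by simp
qed (use frobenius_mat_carrier cohomology_basis_monomials in auto)

text \<open>With \<open>P\<close> the base change and \<open>?P2\<close> its entrywise square,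
  \<open>P * A = frobenius_mat g h * ?P2\<close>. Both are invertible, so the rank does not depend
  on the basis.\<close>

lemma rank_hasse_witt_matrix:
  assumes "hasse_witt_matrix g H1 H0 A"
  shows "vec_space.rank g A = vec_space.rank g (frobenius_mat g h)"
proof -
  obtain b where A: "A \<in> carrier_mat g g" and b: "cohomology_basis g H1 H0 b"
    and bA: "\<And>j. j < g \<Longrightarrow> b j ^ 2 - (\<Sum>i<g. const_fn (A $$ (i, j)) * b i) \<in> coboundaries g H1 H0"
    using assms unfolding hasse_witt_matrix_def char_2 by blast
  have "\<exists>k. has_class (b j) k" if "j < g" for j
    using b that has_class_exists unfolding cohomology_basis_def by metis
  then obtain k where k: "\<And>j. j < g \<Longrightarrow> has_class (b j) (k j)" by metis
  define P where "P = mat g g (\<lambda>(i, j). k j i)"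
  have P: "P \<in> carrier_mat g g" by (simp add: P_def)
  \<comment> \<open>A null vector of \<open>P\<close> gives a nontrivial combination of the
    \<open>b j\<close> with zero coordinates, that is, a coboundary.\<close>
  have "det P \<noteq> 0"
  proof
    assume "det P = 0"
    then obtain v where v: "v \<in> carrier_vec g" "v \<noteq> 0\<^sub>v g" "P *\<^sub>v v = 0\<^sub>v g"
      using det_0_iff_vec_prod_zero_field[OF P] by blast
    have "has_class (\<Sum>j<g. const_fn (v $ j) * b j) (\<lambda>i. \<Sum>j<g. v $ j * k j i)"
      by (rule has_class_sum) (use k in auto)
    moreover have "(\<Sum>j<g. v $ j * k j i) = 0" if "i < g" for i
    proof -
      have "(P *\<^sub>v v) $ i = (\<Sum>j<g. v $ j * k j i)"
        using that v(1) by (simp add: P_def scalar_prod_def atLeast0LessThan mult.commute)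
      thus ?thesis using v(3) that by simp
    qed
    ultimately have "has_class (\<Sum>j<g. const_fn (v $ j) * b j) (\<lambda>i. 0)" by (rule has_class_cong)
    hence "\<forall>i<g. v $ i = 0"
      using b unfolding has_class_0_iff cohomology_basis_def by blast
    thus False using v(1,2) by (metis eq_vecI carrier_vecD index_zero_vec)
  qed
  let ?P2 = "map_mat (\<lambda>a. a ^ 2) P"
  have two: "(2 :: 'a) = 0" using of_nat_CHAR[where 'a = 'a] char_2 by simp
  \<comment> \<open>Squaring is a ring homomorphism in characteristic 2, so \<open>det ?P2\<close>
    is the square of \<open>det P\<close>.\<close>
  interpret sq: comm_ring_hom "\<lambda>a::'a. a ^ 2"
    by unfold_locales (simp_all add: power2_sum two power_mult_distrib)
  \<comment> \<open>Column \<open>j\<close> of either side holds the coordinates of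
    \<open>b j ^ 2\<close>, computed through \<open>A\<close> and through the squared coordinates of
    \<open>b j\<close>.\<close>
  have "P * A = (frobenius_mat g h) * ?P2"
  proof (rule eq_matI)
    fix l j assume "l < dim_row ((frobenius_mat g h) * ?P2)" "j < dim_col ((frobenius_mat g h) * ?P2)"
    hence lj: "l < g" "j < g" using P frobenius_mat_carrier by auto
    have "has_class (\<Sum>i<g. const_fn (A $$ (i, j)) * b i) (\<lambda>l. \<Sum>i<g. A $$ (i, j) * k i l)"
      by (rule has_class_sum) (use k in auto)
    from has_class_cong_coboundary[OF this bA[OF lj(2)]]
    have "has_class (b j ^ 2) (\<lambda>l. \<Sum>i<g. A $$ (i, j) * k i l)" .
    from has_class_unique[OF this has_class_square[OF k[OF lj(2)]] lj(1)]
    show "(P * A) $$ (l, j) = ((frobenius_mat g h) * ?P2) $$ (l, j)"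
      using lj A P frobenius_mat_carrier
      by (simp add: P_def scalar_prod_def atLeast0LessThan mult.commute)
  qed (use A P frobenius_mat_carrier in auto)
  moreover have "det ?P2 \<noteq> 0" using \<open>det P \<noteq> 0\<close> sq.hom_det[of P] by (metis zero_eq_power2)
  ultimately show ?thesis
    using rank_mult_left_invertible[OF P \<open>det P \<noteq> 0\<close> A]
      rank_mult_right_invertible[of ?P2 g "frobenius_mat g h" g] P frobenius_mat_carrier[of g h] by simp
qed

end

end

section \<open>The left kernel of the Hasse-Witt matrix\<close>

lemma of_nat_eq_0_iff_even:
  assumes "CHAR('a::semiring_1) = 2"
  shows "of_nat n = (0 :: 'a) \<longleftrightarrow> even n"
  by (simp add: of_nat_eq_0_iff_char_dvd assms)

text \<open>Derivation multiplies coefficient \<open>n\<close> by \<open>n\<close>, which is nonzero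
  in characteristic 2 exactly for odd \<open>n\<close>.\<close>

lemma pderiv_eq_0_iff_char_2:
  fixes p :: "'a::idom poly"
  assumes "CHAR('a) = 2"
  shows "pderiv p = 0 \<longleftrightarrow> (\<forall>n. odd n \<longrightarrow> poly.coeff p n = 0)"
proof -
  have "poly.coeff (pderiv p) n = 0 \<longleftrightarrow> (odd (Suc n) \<longrightarrow> poly.coeff p (Suc n) = 0)" for n
    unfolding coeff_pderiv mult_eq_0_iff of_nat_eq_0_iff_even[OF assms] by blast
  moreover have "(\<forall>n. odd n \<longrightarrow> poly.coeff p n = 0) \<longleftrightarrow> (\<forall>n. odd (Suc n) \<longrightarrow> poly.coeff p (Suc n) = 0)"
    by (metis even_zero not0_implies_Suc)
  ultimately show ?thesis by (simp add: poly_eq_iff)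
qed

lemma pderiv_pderiv_char_2:
  fixes p :: "'a::idom poly"
  assumes "CHAR('a) = 2"
  shows "pderiv (pderiv p) = 0"
  unfolding pderiv_eq_0_iff_char_2[OF assms] coeff_pderiv mult_eq_0_iff of_nat_eq_0_iff_even[OF assms]
  by simp

lemma even_degree_char_2:
  fixes p :: "'a::idom poly"
  assumes "CHAR('a) = 2" "pderiv p = 0"
  shows "even (degree p)"
  using assms(2) unfolding pderiv_eq_0_iff_char_2[OF assms(1)]
  by (metis even_zero degree_0 leading_coeff_0_iff)

lemma degree_pderiv_le: "degree (pderiv p) \<le> degree p - 1"
  by (rule degree_le) (auto simp: coeff_pderiv coeff_eq_0)

text \<open>The first derivative of \<open>d r\<close> shows that \<open>d\<close> divides
  \<open>d' r\<close>, the vanishing second one that it divides \<open>d' s\<close>. By coprimality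
  \<open>d\<close> divides \<open>d'\<close>, which has smaller degree unless it is 0.\<close>

lemma pderiv_eq_0_dvd_char_2:
  fixes d r s :: "'a::field_gcd poly"
  assumes char_2: "CHAR('a) = 2" and h: "pderiv (d * r) = d * s" and rs: "coprime r s" and d: "d \<noteq> 0"
  shows "pderiv d = 0" "pderiv r = s"
proof -
  have "d dvd pderiv d * r"
  proof -
    have "pderiv d * r = d * (s - pderiv r)" using h by (simp add: pderiv_mult algebra_simps)
    thus ?thesis by simp
  qed
  moreover have "d dvd pderiv d * s"
  proof -
    have "pderiv (d * s) = 0" unfolding h[symmetric] by (rule pderiv_pderiv_char_2[OF char_2])
    hence "pderiv d * s = d * (- pderiv s)" by (simp add: pderiv_mult algebra_simps eq_neg_iff_add_eq_0)
    thus ?thesis by (metis dvd_triv_left)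
  qed
  ultimately have "d dvd gcd (pderiv d * r) (pderiv d * s)" by simp
  hence "d dvd pderiv d" using rs by (simp add: gcd_mult_left coprime_iff_gcd_eq_1[symmetric] flip: coprime_iff_gcd_eq_1)
  hence "\<not> degree (pderiv d) < degree d \<or> pderiv d = 0" using dvd_imp_degree_le linorder_not_le by blast
  moreover have "degree (pderiv d) < degree d \<or> pderiv d = 0"
    using degree_pderiv_le[of d] by (cases "degree d = 0") (auto elim: degree_eq_zeroE)
  ultimately show d': "pderiv d = 0" by blast
  show "pderiv r = s" using h d d' by (simp add: pderiv_mult)
qed

text \<open>\<open>d\<close> is a gcd of \<open>h\<close> and its derivative, given through coprime
  cofactors that can later be homogenised separately.\<close>

locale char_2_factorization =
  fixes h d r s :: "'a::field_gcd poly"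
  assumes char_2: "CHAR('a) = 2" and h_nz: "h \<noteq> 0"
    and h_eq: "h = d * r" and h'_eq: "pderiv h = d * s" and coprime_r_s: "coprime r s"
begin

lemma nz: "d \<noteq> 0" "r \<noteq> 0"
  using h_nz h_eq by auto

lemma pderiv_d: "pderiv d = 0" and pderiv_r: "pderiv r = s"
  using pderiv_eq_0_dvd_char_2[OF char_2 h'_eq[unfolded h_eq] coprime_r_s nz(1)] by auto

lemma two_eq_0: "(2 :: 'a poly) = 0"
  using of_nat_CHAR[where 'a = 'a] char_2 by (simp add: numeral_poly)

text \<open>As \<open>d' = 0\<close>, the condition says \<open>(v r)' = 0\<close>, that is
  \<open>v s = - r v'\<close>, and coprimality gives \<open>r dvd v\<close>. For
  \<open>v = r w\<close>, \<open>(r^2 w)' = r^2 w'\<close> in characteristic 2.\<close>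

lemma pderiv_mult_h_eq_0_iff: "pderiv (v * h) = 0 \<longleftrightarrow> (\<exists>w. v = r * w \<and> pderiv w = 0)"
proof
  assume "pderiv (v * h) = 0"
  hence "d * pderiv (v * r) = 0"
    unfolding h_eq by (simp add: pderiv_mult pderiv_d algebra_simps)
  hence *: "pderiv (v * r) = 0" using nz by simp
  hence "v * s = r * (- pderiv v)" by (simp add: pderiv_mult pderiv_r algebra_simps eq_neg_iff_add_eq_0)
  hence "r dvd v * s" by (metis dvd_triv_left)
  hence "r dvd v" using coprime_r_s by (simp add: coprime_dvd_mult_left_iff)
  then obtain w where w: "v = r * w" by blast
  have "pderiv (r * w * r) = r ^ 2 * pderiv w + 2 * (r * w * pderiv r)"
    by (simp add: pderiv_mult algebra_simps power2_eq_square)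
  also have "\<dots> = r ^ 2 * pderiv w" unfolding two_eq_0 by simp
  finally have "r ^ 2 * pderiv w = 0" using * unfolding w by (simp add: ac_simps)
  hence "pderiv w = 0" using nz by simp
  thus "\<exists>w. v = r * w \<and> pderiv w = 0" using w by blast
next
  assume "\<exists>w. v = r * w \<and> pderiv w = 0"
  then obtain w where w: "v = r * w" "pderiv w = 0" by blast
  have "pderiv (v * h) = d * (r ^ 2 * pderiv w + 2 * (r * w * pderiv r)) + pderiv d * (r * w * r)"
    unfolding w(1) h_eq by (simp add: pderiv_mult algebra_simps power2_eq_square)
  thus "pderiv (v * h) = 0" by (simp add: two_eq_0 w(2) pderiv_d)
qed

text \<open>Entry \<open>j\<close> of the product is the coefficient at \<open>2 * j + 1\<close> of
  \<open>h\<close> times the polynomial of \<open>v\<close>. That polynomial has degree at most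
  \<open>(g - 1) + (g + 1)\<close>, so the indices \<open>j < g\<close> cover all its odd
  coefficients.\<close>

lemma left_kernel_frobenius_mat:
  assumes v: "v \<in> carrier_vec g" and deg_h: "degree h \<le> g + 1"
  shows "(frobenius_mat g h)\<^sup>T *\<^sub>v v = 0\<^sub>v g \<longleftrightarrow> pderiv ((\<Sum>i<g. monom (v $ i) i) * h) = 0"
proof -
  define V where "V = (\<Sum>i<g. monom (v $ i) i)"
  have coeff_V: "poly.coeff V n = (if n < g then v $ n else 0)" for n
    unfolding V_def coeff_sum coeff_monom by simp
  have entry: "((frobenius_mat g h)\<^sup>T *\<^sub>v v) $ j = poly.coeff (V * h) (2 * j + 1)" if j: "j < g" for j
  proof -
    have "((frobenius_mat g h)\<^sup>T *\<^sub>v v) $ j = (\<Sum>i<g. (if i \<le> 2 * j + 1 then poly.coeff h (2 * j + 1 - i) else 0) * v $ i)"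
      using j v by (simp add: frobenius_mat_def scalar_prod_def atLeast0LessThan)
    also have "\<dots> = (\<Sum>i\<le>2 * j + 1. if i < g then poly.coeff h (2 * j + 1 - i) * v $ i else 0)"
      by (intro sum.mono_neutral_cong) auto
    also have "\<dots> = poly.coeff (V * h) (2 * j + 1)"
      unfolding coeff_mult coeff_V by (intro sum.cong) auto
    finally show ?thesis .
  qed
  have deg: "poly.coeff (V * h) n = 0" if "odd n" "n \<ge> 2 * g" for n
  proof (cases "g = 0")
    case True
    thus ?thesis by (simp add: V_def)
  next
    case False
    have "degree V \<le> g - 1" using False by (intro degree_le) (auto simp: coeff_V)
    hence "degree (V * h) \<le> 2 * g" using degree_mult_le[of V h] deg_h False by linarith
    moreover have "n \<noteq> 2 * g" using that by auto
    ultimately show ?thesis using that by (intro coeff_eq_0) linarith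
  qed
  have "(frobenius_mat g h)\<^sup>T *\<^sub>v v = 0\<^sub>v g \<longleftrightarrow> (\<forall>j<g. poly.coeff (V * h) (2 * j + 1) = 0)"
    using entry by (auto simp: vec_eq_iff frobenius_mat_def)
  also have "\<dots> \<longleftrightarrow> (\<forall>n. odd n \<longrightarrow> poly.coeff (V * h) n = 0)"
  proof
    assume *: "\<forall>j<g. poly.coeff (V * h) (2 * j + 1) = 0"
    show "\<forall>n. odd n \<longrightarrow> poly.coeff (V * h) n = 0"
    proof (intro allI impI)
      fix n :: nat assume n: "odd n"
      then obtain j where j: "n = 2 * j + 1" by (elim oddE)
      show "poly.coeff (V * h) n = 0"
        by (cases "j < g") (use * j deg[OF n] in auto)
    qed
  qed auto
  finally show ?thesis unfolding pderiv_eq_0_iff_char_2[OF char_2] V_def .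
qed

text \<open>The left kernel consists of the \<open>r w\<close> of degree below \<open>g\<close> with
  \<open>w' = 0\<close>. The degrees of its nonzero elements are the numbers
  \<open>degree r + 2 * i\<close> below \<open>g\<close>, which serve as pivots.\<close>

lemma rank_frobenius_mat:
  assumes deg_h: "degree h \<le> g + 1"
  shows "vec_space.rank g (frobenius_mat g h) = g - (g + 1 - degree r) div 2"
proof -
  define k where "k = (g + 1 - degree r) div 2"
  define D where "D = (\<lambda>i. degree r + 2 * i) ` {..<k}"
  let ?V = "\<lambda>v. \<Sum>i<g. monom (v $ i) i"
  have coeff_V: "poly.coeff (?V v) n = (if n < g then v $ n else 0)" for v :: "'a vec" and n
    unfolding coeff_sum coeff_monom by simp
  have "vec_space.rank g (frobenius_mat g h) = g - card D"
  proof (rule rank_eq_of_left_kernel_echelon[OF frobenius_mat_carrier])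
    show sub: "D \<subseteq> {..<g}" unfolding D_def k_def by auto
    fix n assume n: "n \<in> D"
    then obtain i where i: "i < k" "n = degree r + 2 * i" by (auto simp: D_def)
    let ?p = "r * monom 1 (2 * i)"
    have p: "degree ?p = n" "?p \<noteq> 0" using nz i by (auto simp: degree_mult_eq degree_monom_eq)
    define v where "v = vec g (poly.coeff ?p)"
    have n_less: "n < g" using sub n by auto
    have Vv: "?V v = ?p"
    proof (rule poly_eqI)
      show "poly.coeff (?V v) m = poly.coeff ?p m" for m
        unfolding coeff_V using p n_less by (cases "m < g") (auto simp: v_def intro: coeff_eq_0)
    qed
    have "pderiv (monom (1::'a) (2 * i)) = 0"
      unfolding pderiv_eq_0_iff_char_2[OF char_2] by auto
    hence "pderiv (?p * h) = 0" unfolding pderiv_mult_h_eq_0_iff by blast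
    hence "(frobenius_mat g h)\<^sup>T *\<^sub>v v = 0\<^sub>v g"
      using left_kernel_frobenius_mat[of v g] deg_h Vv by (simp add: v_def)
    moreover have "v $ n \<noteq> 0" using p n_less by (metis index_vec leading_coeff_0_iff v_def)
    moreover have "\<forall>j<g. n < j \<longrightarrow> v $ j = 0" using p by (auto simp: v_def intro: coeff_eq_0)
    ultimately show "\<exists>v\<in>carrier_vec g. (frobenius_mat g h)\<^sup>T *\<^sub>v v = 0\<^sub>v g \<and> v $ n \<noteq> 0 \<and> (\<forall>i<g. n < i \<longrightarrow> v $ i = 0)"
      by (intro bexI[of _ v]) (auto simp: v_def)
  next
    fix v assume v: "v \<in> carrier_vec g" "(frobenius_mat g h)\<^sup>T *\<^sub>v v = 0\<^sub>v g" "\<forall>d\<in>D. v $ d = 0"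
    then obtain w where w: "?V v = r * w" "pderiv w = 0"
      using left_kernel_frobenius_mat[OF v(1) deg_h] pderiv_mult_h_eq_0_iff by blast
    have "w = 0"
    proof (rule ccontr)
      assume "w \<noteq> 0"
      \<comment> \<open>The even degree of \<open>w\<close> puts the leading exponent of
        \<open>r w\<close> into \<open>D\<close>, where \<open>v\<close> vanishes.\<close>
      obtain i where i: "degree w = 2 * i" using even_degree_char_2[OF char_2 w(2)] by (elim evenE)
      have deg: "degree (?V v) = degree r + 2 * i"
        unfolding w i[symmetric] using \<open>w \<noteq> 0\<close> nz by (simp add: degree_mult_eq)
      have "?V v \<noteq> 0" unfolding w using \<open>w \<noteq> 0\<close> nz by simp
      hence nz': "poly.coeff (?V v) (degree r + 2 * i) \<noteq> 0" unfolding deg[symmetric] by simp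
      hence "degree r + 2 * i < g" unfolding coeff_V by (auto split: if_splits)
      hence "i < k" unfolding k_def by simp
      hence "v $ (degree r + 2 * i) = 0" using v(3) by (auto simp: D_def)
      thus False using nz' unfolding coeff_V by (auto split: if_splits)
    qed
    hence "?V v = 0" using w by simp
    hence "v $ n = 0" if "n < g" for n using coeff_V[of v n] that by simp
    thus "v = 0\<^sub>v g" using v(1) by (intro eq_vecI) auto
  qed
  moreover have "card D = k" unfolding D_def by (subst card_image) (auto simp: inj_on_def)
  ultimately show ?thesis by (simp add: k_def)
qed

end

section \<open>Homogenisation\<close>

text \<open>For \<open>degree p \<le> d\<close>, the form of degree \<open>d\<close> with value
  \<open>p\<close> at \<open>Z = 1\<close>. A \<open>d\<close> above \<open>degree p\<close> adds a
  factor \<open>Z^(d - degree p)\<close>, which records powers of \<open>Z\<close> in a gcd.\<close>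

definition homogenize :: "nat \<Rightarrow> 'a::comm_ring_1 poly \<Rightarrow> 'a poly poly" where
  "homogenize d p = (\<Sum>i\<le>d. monom (monom (poly.coeff p i) (d - i)) i)"

lemma coeff_homogenize:
  assumes "degree p \<le> d"
  shows "poly.coeff (homogenize d p) i = monom (poly.coeff p i) (d - i)"
proof -
  have "poly.coeff (homogenize d p) i = (\<Sum>j\<le>d. if j = i then monom (poly.coeff p j) (d - j) else 0)"
    unfolding homogenize_def coeff_sum coeff_monom by (intro sum.cong) auto
  also have "\<dots> = monom (poly.coeff p i) (d - i)"
    using assms by (auto simp: coeff_eq_0)
  finally show ?thesis .
qed

lemma homogenize_0 [simp]: "homogenize d 0 = 0"
  by (simp add: homogenize_def)

lemma homogenize_eq_0_iff: "degree p \<le> d \<Longrightarrow> homogenize d p = 0 \<longleftrightarrow> p = 0"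
  by (simp add: poly_eq_iff[of "homogenize d p"] poly_eq_iff[of p] coeff_homogenize)

lemma homogenize_mult:
  assumes p: "degree p \<le> d" and q: "degree q \<le> e"
  shows "homogenize d p * homogenize e q = homogenize (d + e) (p * q)"
proof (rule poly_eqI)
  fix i
  have "degree (p * q) \<le> d + e" using degree_mult_le[of p q] p q by linarith
  note [simp] = coeff_homogenize[OF p] coeff_homogenize[OF q] coeff_homogenize[OF this]
  have "poly.coeff (homogenize d p * homogenize e q) i
      = (\<Sum>a\<le>i. monom (poly.coeff p a * poly.coeff q (i - a)) (d - a + (e - (i - a))))"
    by (simp add: coeff_mult mult_monom)
  \<comment> \<open>Where truncated subtraction could make the exponents differ, one of the two
    coefficients is 0.\<close>
  also have "\<dots> = (\<Sum>a\<le>i. monom (poly.coeff p a * poly.coeff q (i - a)) (d + e - i))"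
  proof (rule sum.cong)
    fix a assume a: "a \<in> {..i}"
    show "monom (poly.coeff p a * poly.coeff q (i - a)) (d - a + (e - (i - a))) =
        monom (poly.coeff p a * poly.coeff q (i - a)) (d + e - i)"
    proof (cases "a \<le> d \<and> i - a \<le> e")
      case True
      hence "d - a + (e - (i - a)) = d + e - i" using a by auto
      thus ?thesis by simp
    next
      case False
      hence "poly.coeff p a = 0 \<or> poly.coeff q (i - a) = 0" using p q by (auto intro: coeff_eq_0)
      thus ?thesis by auto
    qed
  qed simp
  also have "\<dots> = poly.coeff (homogenize (d + e) (p * q)) i"
    by (simp add: coeff_mult monom_sum)
  finally show "poly.coeff (homogenize d p * homogenize e q) i = poly.coeff (homogenize (d + e) (p * q)) i" .
qed

lemma homogenize_add: "homogenize d (p + q) = homogenize d p + homogenize d q"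
  by (simp add: homogenize_def add_monom[symmetric] sum.distrib)

lemma homogenize_1: "homogenize d 1 = Z_var ^ d"
proof -
  have "homogenize d (1 :: 'a poly) = [:monom 1 d:]"
    by (intro poly_eqI) (simp add: coeff_homogenize coeff_pCons split: nat.split)
  also have "\<dots> = Z_var ^ d"
  proof (induction d)
    case (Suc d)
    show ?case unfolding power_Suc Suc.IH[symmetric] by (simp add: monom_Suc)
  qed (simp add: monom_0 pCons_one)
  finally show ?thesis .
qed

lemma homogeneous_homogenize:
  assumes "degree p \<le> d" shows "homogeneous d (homogenize d p)"
  unfolding homogeneous_def coeff_homogenize[OF assms]
  using assms by (auto simp: coeff_eq_0 not_less split: if_splits dest: le_degree)

text \<open>The coefficient of \<open>X^i\<close> in a form of degree \<open>d\<close> is a scalar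
  multiple of \<open>Z^(d-i)\<close>, so setting \<open>Z = 1\<close> loses nothing.\<close>

lemma homogeneous_imp_homogenize:
  assumes "homogeneous d H"
  defines "h \<equiv> map_poly (\<lambda>c. poly c 1) H"
  shows "degree h \<le> d" "H = homogenize d h"
proof -
  have H: "poly.coeff H i = (if i \<le> d then monom (poly.coeff (poly.coeff H i) (d - i)) (d - i) else 0)" for i
  proof (rule poly_eqI)
    fix n
    have "poly.coeff (poly.coeff H i) n = 0" if "i + n \<noteq> d"
      using assms(1) that unfolding homogeneous_def by blast
    thus "poly.coeff (poly.coeff H i) n =
        poly.coeff (if i \<le> d then monom (poly.coeff (poly.coeff H i) (d - i)) (d - i) else 0) n"
      by (cases "i + n = d") auto
  qed
  have h: "poly.coeff h i = (if i \<le> d then poly.coeff (poly.coeff H i) (d - i) else 0)" for i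
    unfolding h_def by (subst coeff_map_poly, simp, subst H) (simp add: poly_monom)
  show deg: "degree h \<le> d" by (rule degree_le) (simp add: h)
  show "H = homogenize d h"
    by (rule poly_eqI) (subst H, simp add: coeff_homogenize[OF deg] h)
qed

text \<open>The coefficient of \<open>X^d\<close> is the constant \<open>lead_coeff p\<close>, which
  \<open>Z\<close> divides only if it is 0.\<close>

lemma Z_dvd_homogenizeD:
  fixes p :: "'a::field poly"
  assumes "degree p = d" "Z_var dvd homogenize d p"
  shows "p = 0"
proof -
  have "[:0, 1:] dvd poly.coeff (homogenize d p) d"
    using assms(2) by (simp add: const_poly_dvd_iff)
  hence "[:0, 1:] dvd [:lead_coeff p:]" using assms(1) by (simp add: coeff_homogenize monom_0)
  hence "poly [:lead_coeff p:] 0 = 0" by (metis poly_eq_0_iff_dvd diff_0 minus_zero neg_equal_0_iff_equal)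
  thus ?thesis by simp
qed

lemma prime_elem_Z: "prime_elem (Z_var :: 'a::field_gcd poly poly)"
  by (simp add: prime_elem_const_poly_iff prime_elem_linear_field_poly)

text \<open>A common divisor divides a power of \<open>Z\<close> by the homogenised Bezout identity.\<close>

lemma coprime_homogenize:
  fixes r s :: "'a::field_gcd poly"
  assumes rs: "coprime r s" and r: "degree r \<le> d" and s: "degree s \<le> e"
    and top: "degree r = d \<and> r \<noteq> 0 \<or> degree s = e \<and> s \<noteq> 0"
  shows "coprime (homogenize d r) (homogenize e s)"
proof (rule coprimeI)
  fix T assume T: "T dvd homogenize d r" "T dvd homogenize e s"
  obtain u v where uv: "u * r + v * s = 1"
    using bezout_coefficients_fst_snd[of r s] rs by (metis coprime_imp_gcd_eq_1)
  \<comment> \<open>Padding by \<open>M\<close> leaves room for \<open>u\<close> and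
    \<open>v\<close> and gives both products the same degree \<open>M + e + d\<close>.\<close>
  define M where "M = degree u + degree v"
  have "homogenize (M + e) u * homogenize d r + homogenize (M + d) v * homogenize e s
      = homogenize (M + e + d) (u * r + v * s)"
    using r s by (simp add: homogenize_mult homogenize_add M_def add.commute add.left_commute)
  also have "\<dots> = Z_var ^ (M + e + d)" by (simp add: uv homogenize_1)
  finally have *: "T dvd Z_var ^ (M + e + d)" using T by (metis dvd_add dvd_mult)
  \<comment> \<open>By \<open>top\<close> one of the two forms has full degree in \<open>X\<close>
    and is not divisible by \<open>Z\<close>.\<close>
  obtain W where W: "T dvd W" "\<not> Z_var dvd W"
    using top Z_dvd_homogenizeD[of r d] Z_dvd_homogenizeD[of s e] T by blast
  have "coprime (Z_var ^ (M + e + d)) W"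
    using prime_elem_imp_coprime[OF prime_elem_Z W(2)] by simp
  thus "is_unit T" using * W(1) by (rule coprime_common_divisor)
qed

section \<open>Degrees and partial derivatives of forms, and the degree of the gcd\<close>

lemma total_degree_homogeneous:
  assumes "homogeneous d H" "H \<noteq> 0"
  shows "total_degree H = d"
proof -
  obtain i j where "poly.coeff (poly.coeff H i) j \<noteq> 0" using assms(2) by (metis leading_coeff_0_iff)
  hence "{i + j |i j. poly.coeff (poly.coeff H i) j \<noteq> 0} = {d}"
    using assms(1) unfolding homogeneous_def by blast
  thus ?thesis unfolding total_degree_def by simp
qed

text \<open>\<open>normalize\<close> divides by a unit, here a nonzero constant of the field, which
  keeps homogeneity and degree.\<close>

lemma total_degree_normalize:
  fixes H :: "'a::field_gcd poly poly"
  assumes "homogeneous d H" "H \<noteq> 0"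
  shows "total_degree (normalize H) = d"
proof (rule total_degree_homogeneous)
  obtain c where c: "normalize H = [:[:c:]:] * H"
  proof -
    have "is_unit (1 div unit_factor H)" using assms(2) by simp
    moreover have "normalize H = 1 div unit_factor H * H"
      by (metis assms(2) mult_1 div_unit_factor unit_div_commute unit_factor_is_unit)
    ultimately show thesis using that by (auto simp: is_unit_poly_iff is_unit_pCons_iff)
  qed
  show "homogeneous d (normalize H)" using assms(1) unfolding c homogeneous_def by auto
qed (use assms in simp)

text \<open>The coefficient at \<open>x^g\<close> is \<open>(g+1) h_(g+1)\<close>, and
  \<open>g + 1\<close> is even.\<close>

lemma degree_pderiv_le_char_2:
  fixes h :: "'a::field poly"
  assumes char_2: "CHAR('a) = 2" and "odd g" "degree h \<le> g + 1"
  shows "degree (pderiv h) \<le> g - 1"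
proof (rule degree_le, intro allI impI)
  fix n assume n: "g - 1 < n"
  show "poly.coeff (pderiv h) n = 0"
  proof (cases "n = g")
    case True
    thus ?thesis unfolding coeff_pderiv mult_eq_0_iff of_nat_eq_0_iff_even[OF char_2] using assms(2) by simp
  next
    case False
    thus ?thesis using n assms(3) by (simp add: coeff_pderiv coeff_eq_0)
  qed
qed

text \<open>In the derivatives of \<open>h_i X^i Z^(g+1-i)\<close> only odd \<open>i\<close>
  survive, and then \<open>g+1-i\<close> is odd too. The results
  \<open>h_i X^(i-1) Z^(g+1-i)\<close> and \<open>h_i X^i Z^(g-i)\<close> are \<open>Z\<close> and
  \<open>X\<close> times the same monomial.\<close>

lemma pderiv_homogenize_char_2:
  fixes h :: "'a::field poly"
  assumes char_2: "CHAR('a) = 2" and "odd g" "degree h \<le> g + 1"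
  shows "pderiv (homogenize (g + 1) h) = Z_var * homogenize (g - 1) (pderiv h)"
    and "map_poly pderiv (homogenize (g + 1) h) = pCons 0 (homogenize (g - 1) (pderiv h))"
proof -
  note deg = degree_pderiv_le_char_2[OF assms]
  note [simp] = coeff_homogenize[OF assms(3)[unfolded Suc_eq_plus1[symmetric]]] coeff_homogenize[OF deg[unfolded One_nat_def]]
  show "pderiv (homogenize (g + 1) h) = Z_var * homogenize (g - 1) (pderiv h)"
  proof (rule poly_eqI)
    fix i
    have "poly.coeff (pderiv (homogenize (g + 1) h)) i = monom (poly.coeff (pderiv h) i) (g - i)"
      by (simp add: coeff_pderiv of_nat_poly smult_monom)
    also have "\<dots> = monom (poly.coeff (pderiv h) i) (Suc (g - 1 - i))"
    proof (cases "i < g")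
      case False
      hence "poly.coeff (pderiv h) i = 0" using deg assms(2) by (intro coeff_eq_0) (cases g; auto)
      thus ?thesis by simp
    qed (simp add: Suc_diff_Suc)
    finally show "poly.coeff (pderiv (homogenize (g + 1) h)) i = poly.coeff (Z_var * homogenize (g - 1) (pderiv h)) i"
      by (simp add: monom_Suc)
  qed
  show "map_poly pderiv (homogenize (g + 1) h) = pCons 0 (homogenize (g - 1) (pderiv h))"
  proof (rule poly_eqI)
    fix i
    show "poly.coeff (map_poly pderiv (homogenize (g + 1) h)) i = poly.coeff (pCons 0 (homogenize (g - 1) (pderiv h))) i"
    proof (cases i)
      case 0
      thus ?thesis using of_nat_eq_0_iff_even[OF char_2, of "Suc g"] assms(2)
        by (simp add: coeff_map_poly pderiv_monom del: of_nat_Suc)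
    next
      case (Suc n)
      have "of_nat (g - n) * poly.coeff h (Suc n) = of_nat (Suc n) * poly.coeff h (Suc n)"
      proof (cases "n \<le> g")
        case True
        have "of_nat (g - n) + of_nat (Suc n) = (of_nat (Suc g) :: 'a)"
          using True by (simp only: of_nat_add[symmetric]) simp
        also have "\<dots> = 0" unfolding of_nat_eq_0_iff_even[OF char_2] using assms(2) by simp
        finally have "of_nat (g - n) = - (of_nat (Suc n) :: 'a)" by (rule add_eq_0_iff2[THEN iffD1])
        thus ?thesis using minus_eq_char_2[OF char_2] by metis
      next
        case False
        hence "poly.coeff h (Suc n) = 0" using assms(3) by (intro coeff_eq_0) simp
        thus ?thesis by simp
      qed
      thus ?thesis using Suc by (simp add: coeff_map_poly pderiv_monom coeff_pderiv del: of_nat_Suc)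
    qed
  qed
qed

context char_2_factorization
begin

text \<open>Homogenising \<open>d\<close> to the even degree on the right includes the common powers
  of \<open>Z\<close>. The two cofactors are coprime because one of them attains its full
  degree.\<close>

lemma total_degree_gcd:
  assumes g: "odd g" and deg_h: "degree h \<le> g + 1"
  shows "total_degree (gcd (homogenize (g + 1) h) (homogenize (g - 1) (pderiv h))) = 2 * ((g + 1 - degree r) div 2)"
proof (cases "s = 0")
  \<comment> \<open>The second form is 0, so the gcd is associated to the first and has the even
    degree \<open>g + 1\<close>.\<close>
  case True
  hence "is_unit r" using coprime_r_s by simp
  hence "degree r = 0" by (auto simp: is_unit_poly_iff)
  moreover have "homogenize (g + 1) h \<noteq> 0" using homogenize_eq_0_iff[OF deg_h] h_nz by simp
  ultimately show ?thesis
    using True g h'_eq total_degree_normalize[OF homogeneous_homogenize[OF deg_h]] by simp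
next
  case False
  define E where "E = 2 * ((g + 1 - degree r) div 2)"
  have deg_h': "degree h = degree d + degree r" unfolding h_eq using nz by (simp add: degree_mult_eq)
  have "degree r \<noteq> 0"
  proof
    assume "degree r = 0"
    hence "pderiv r = 0" by (auto elim: degree_eq_zeroE)
    thus False using False pderiv_r by simp
  qed
  obtain m where m: "g = 2 * m + 1" using g by (elim oddE)
  have E_bounds: "E \<le> g + 1 - degree r" "g + 1 - degree r \<le> E + 1" and "even E"
    unfolding E_def by auto
  obtain e where e: "E = 2 * e" using \<open>even E\<close> by (elim evenE)
  obtain a where a: "degree d = 2 * a" using even_degree_char_2[OF char_2 pderiv_d] by (elim evenE)
  have E_le: "E \<le> g - 1" using E_bounds \<open>degree r \<noteq> 0\<close> unfolding m e by arith
  \<comment> \<open>\<open>degree d\<close> is even, so the bound \<open>g + 1 - degree r\<close>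
    may be rounded down to \<open>E\<close>.\<close>
  have d_E: "degree d \<le> E" using E_bounds deg_h unfolding deg_h' m e a by arith
  have r_E: "degree r \<le> g + 1 - E" using E_bounds deg_h deg_h' by arith
  have "pderiv s = 0" unfolding pderiv_r[symmetric] by (rule pderiv_pderiv_char_2[OF char_2])
  hence "even (degree s)" by (rule even_degree_char_2[OF char_2])
  then obtain b where b: "degree s = 2 * b" by (elim evenE)
  have s_r: "degree s \<le> degree r - 1" unfolding pderiv_r[symmetric] by (rule degree_pderiv_le)
  \<comment> \<open>For even \<open>degree r\<close>, the parity of \<open>degree s\<close> improves
    the bound \<open>degree r - 1\<close> to \<open>degree r - 2\<close>.\<close>
  have s_E: "degree s \<le> g - 1 - E"
    using s_r r_E E_le \<open>degree r \<noteq> 0\<close> unfolding m e b by arith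
  \<comment> \<open>For even \<open>degree r\<close> nothing was rounded and \<open>r\<close> has
    full degree. For odd \<open>degree r\<close> its leading term survives derivation, so
    \<open>degree s = degree r - 1\<close>.\<close>
  have top: "degree r = g + 1 - E \<and> r \<noteq> 0 \<or> degree s = g - 1 - E \<and> s \<noteq> 0"
  proof (cases "even (degree r)")
    case True
    then obtain l where "degree r = 2 * l" by (elim evenE)
    hence "degree r = g + 1 - E" using E_bounds deg_h deg_h' unfolding m e by arith
    thus ?thesis using nz by simp
  next
    case odd: False
    have "poly.coeff s (degree r - 1) = of_nat (degree r) * lead_coeff r"
      using \<open>degree r \<noteq> 0\<close> by (simp add: coeff_pderiv flip: pderiv_r)
    also have "\<dots> \<noteq> 0" using odd nz unfolding mult_eq_0_iff of_nat_eq_0_iff_even[OF char_2] by simp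
    finally have "degree r - 1 \<le> degree s" by (rule le_degree)
    moreover obtain l where "degree r = 2 * l + 1" using odd by (elim oddE)
    ultimately have "degree s = g - 1 - E" using s_E E_bounds deg_h deg_h' E_le unfolding m e by arith
    thus ?thesis using \<open>s \<noteq> 0\<close> by simp
  qed
  have "homogenize (g + 1) h = homogenize E d * homogenize (g + 1 - E) r"
    using homogenize_mult[OF d_E r_E] E_le by (simp add: h_eq)
  moreover have "homogenize (g - 1) (pderiv h) = homogenize E d * homogenize (g - 1 - E) s"
  proof -
    have "E + (g - 1 - E) = g - 1" using E_le by simp
    thus ?thesis by (simp only: h'_eq homogenize_mult[OF d_E s_E])
  qed
  ultimately have "gcd (homogenize (g + 1) h) (homogenize (g - 1) (pderiv h)) = normalize (homogenize E d)"
    using coprime_homogenize[OF coprime_r_s r_E s_E top] by (simp add: gcd_mult_left)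
  thus ?thesis
    using total_degree_normalize[OF homogeneous_homogenize[OF d_E]] homogenize_eq_0_iff[OF d_E] nz
    by (simp add: E_def)
qed

end

section \<open>Singular points\<close>

lemma poly_map_poly_to_ac_shift:
  "poly (map_poly to_ac ([:0, 1:] * c)) z = z * poly (map_poly to_ac c) z"
  by (simp add: map_poly_pCons)

lemma eval2_0 [simp]: "eval2 to_ac 0 x z = 0"
  by (simp add: eval2_def)

lemma eval2_1 [simp]: "eval2 to_ac 1 x z = 1"
  by (simp add: eval2_def map_poly_1)

lemma eval2_pCons_0: "eval2 to_ac (pCons 0 H) x z = x * eval2 to_ac H x z"
  by (simp add: eval2_def map_poly_pCons)

lemma eval2_Z_mult: "eval2 to_ac (Z_var * H) x z = z * eval2 to_ac H x z"
proof (induction H)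
  case (pCons a H)
  have "Z_var * pCons a H = pCons ([:0, 1:] * a) (Z_var * H)" by simp
  thus ?case using pCons.IH unfolding eval2_def
    by (simp add: map_poly_pCons poly_map_poly_to_ac_shift algebra_simps del: mult_pCons_left)
qed simp

lemma eval2_homogenize_at_Z_1:
  assumes "degree p \<le> n"
  shows "eval2 to_ac (homogenize n p) x 1 = poly (map_poly to_ac p) x"
proof -
  have "map_poly (\<lambda>c. poly (map_poly to_ac c) 1) (homogenize n p) = map_poly to_ac p"
    by (intro poly_eqI) (simp add: coeff_map_poly coeff_homogenize[OF assms] map_poly_monom poly_monom)
  thus ?thesis by (simp add: eval2_def)
qed

lemma eval2_homogenize_const_at_Z_0:
  assumes "n > 0"
  shows "eval2 to_ac (homogenize n [:c:]) x 0 = 0"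
proof -
  have "homogenize n [:c:] = [:monom c n:]"
    by (intro poly_eqI) (simp add: coeff_homogenize coeff_pCons split: nat.split)
  thus ?thesis using assms by (simp add: eval2_def map_poly_pCons map_poly_monom poly_monom)
qed

text \<open>A nonconstant \<open>p\<close> has a root \<open>x\<close>, which gives the point
  \<open>(x, 1)\<close>; a constant one gives a multiple of \<open>Z^n\<close>, which vanishes at
  \<open>(1, 0)\<close>.\<close>

lemma homogenize_has_zero:
  fixes p :: "'a::field poly"
  assumes "degree p \<le> n" "n > 0"
  obtains x z :: "'a alg_closure" where "(x, z) \<noteq> (0, 0)" "eval2 to_ac (homogenize n p) x z = 0"
proof (cases "degree p = 0")
  case True
  then obtain c where "p = [:c:]" by (elim degree_eq_zeroE)
  thus thesis using that[of 1 0] eval2_homogenize_const_at_Z_0[OF assms(2), of c 1] by simp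
next
  case False
  hence "degree (map_poly to_ac p) > 0" by (simp add: degree_map_poly)
  then obtain x where "poly (map_poly to_ac p) x = 0" using alg_closed_imp_poly_has_root by blast
  thus thesis using that[of x 1] eval2_homogenize_at_Z_1[OF assms(1)] by simp
qed

text \<open>
  In characteristic 2, both partial derivatives of a form of even degree \<open>2 * g + 2\<close> are multiples of
  one form of degree \<open>2 * g\<close>; above a zero of that form the curve \<open>Y\<^sup>2 = H0\<close> is singular.
\<close>

lemma smooth_model_imp_H1_nonzero:
  fixes H1 H0 :: "'a::field poly poly"
  assumes char_2: "CHAR('a) = 2" and H0: "homogeneous (2 * g + 2) H0" and g: "g > 0"
    and smooth: "smooth_model H1 H0"
  shows "H1 \<noteq> 0"
proof
  assume H1: "H1 = 0"
  define f where "f = map_poly (\<lambda>c. poly c 1) (- H0)"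
  have "homogeneous (2 * g + 2) (- H0)" using H0 by (simp add: homogeneous_def)
  \<comment> \<open>Writing the degree as \<open>(2 * g + 1) + 1\<close> prepares for
    \<open>pderiv_homogenize_char_2\<close> with the odd number \<open>2 * g + 1\<close> in place of
    \<open>g\<close>.\<close>
  hence deg: "degree f \<le> 2 * g + 1 + 1" and H: "- H0 = homogenize (2 * g + 1 + 1) f"
    using homogeneous_imp_homogenize[of "2 * g + 2" "- H0"] by (simp_all add: f_def)
  have odd: "odd (2 * g + 1)" by simp
  let ?G = "homogenize (2 * g) (pderiv f)"
  have deg': "degree (pderiv f) \<le> 2 * g"
    using degree_pderiv_le_char_2[OF char_2 odd deg] by simp
  have dX: "pderiv (- H0) = Z_var * ?G" and dZ: "map_poly pderiv (- H0) = pCons 0 ?G"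
    unfolding H using pderiv_homogenize_char_2[OF char_2 odd deg] by simp_all
  obtain x z :: "'a alg_closure" where xz: "(x, z) \<noteq> (0, 0)" "eval2 to_ac ?G x z = 0"
    using homogenize_has_zero[OF deg'] g by auto
  \<comment> \<open>With \<open>H1 = 0\<close> a point above \<open>(x, z)\<close> is given by a
    square root of \<open>H0(x, z)\<close>, and the derivative \<open>2 Y\<close> vanishes
    identically.\<close>
  have "degree [:eval2 to_ac (- H0) x z, 0, 1:] > 0" by simp
  then obtain y where y: "poly [:eval2 to_ac (- H0) x z, 0, 1:] y = 0"
    using alg_closed_imp_poly_has_root by blast
  have "(2 :: 'a) = 0" using of_nat_CHAR[where 'a = 'a] char_2 by simp
  hence two: "(2 :: 'a poly poly) = 0" by (simp add: numeral_poly)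
  let ?F = "curve_eq H1 H0"
  have "eval3 to_ac ?F x y z = 0"
    using y by (simp add: eval3_def curve_eq_def H1 map_poly_pCons)
  moreover have "eval3 to_ac (map_poly pderiv ?F) x y z = 0"
    by (simp add: eval3_def curve_eq_def H1 map_poly_pCons dX eval2_Z_mult xz(2) del: pderiv_minus mult_pCons_left)
  moreover have "eval3 to_ac (pderiv ?F) x y z = 0"
    by (simp add: eval3_def curve_eq_def H1 map_poly_pCons pderiv_pCons two)
  moreover have "eval3 to_ac (map_poly (map_poly pderiv) ?F) x y z = 0"
    by (simp add: eval3_def curve_eq_def H1 map_poly_pCons map_poly_1 dZ eval2_pCons_0 xz(2))
  moreover have "(x, y, z) \<noteq> (0, 0, 0)" using xz(1) by auto
  ultimately show False using smooth unfolding smooth_model_def Let_def by blast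
qed

section \<open>Rank formula, lower bound and the case of equality\<close>

theorem theorem17:
  fixes H1 H0 :: "'k::field_gcd poly poly" and g :: nat
  assumes "perfect_field TYPE('k)" and "CHAR('k) = 2"
    and "odd g" and "g \<ge> 3"
    and "homogeneous (g + 1) H1" and "homogeneous (2 * g + 2) H0"
    and "smooth_model H1 H0"
  shows "(\<exists>A. hasse_witt_matrix g H1 H0 A) \<and>
    (\<forall>A. hasse_witt_matrix g H1 H0 A \<longrightarrow>
       real (vec_space.rank g A)
         = real g - 1 / 2 * real (total_degree (gcd H1 (pderiv H1 div Z_var))) \<and>
       real (vec_space.rank g A) \<ge> (real g - 1) / 2 \<and>
       (real (vec_space.rank g A) = (real g - 1) / 2 \<longleftrightarrow> pderiv H1 = 0))"
proof -
  define h where "h = map_poly (\<lambda>c. poly c 1) H1"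
  define f where "f = map_poly (\<lambda>c. poly c 1) H0"
  have deg_h: "degree h \<le> g + 1" and H1: "H1 = homogenize (g + 1) h"
    using homogeneous_imp_homogenize[OF assms(5)] by (simp_all add: h_def)
  have deg_f: "degree f \<le> 2 * g + 2"
    using homogeneous_imp_homogenize(1)[OF assms(6)] by (simp add: f_def)
  have "H1 \<noteq> 0" using smooth_model_imp_H1_nonzero[OF assms(2,6) _ assms(7)] assms(4) by simp
  hence "h \<noteq> 0" using H1 by auto
  define d where "d = gcd h (pderiv h)"
  define r where "r = h div d"
  define s where "s = pderiv h div d"
  interpret char_2_factorization h d r s
    using assms(2) \<open>h \<noteq> 0\<close> unfolding d_def r_def s_def
    by unfold_locales (auto intro: div_gcd_coprime)
  \<comment> \<open>The dimension of the left kernel, and half the degree of the gcd of the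
    forms.\<close>
  define k where "k = (g + 1 - degree r) div 2"
  have deg_h': "degree (pderiv h) \<le> g - 1" by (rule degree_pderiv_le_char_2[OF assms(2,3) deg_h])
  have dH1: "pderiv H1 = Z_var * homogenize (g - 1) (pderiv h)"
    unfolding H1 by (rule pderiv_homogenize_char_2(1)[OF assms(2,3) deg_h])
  have "pderiv H1 div Z_var = homogenize (g - 1) (pderiv h)"
    unfolding dH1 by (rule nonzero_mult_div_cancel_left) simp
  hence deg_gcd: "total_degree (gcd H1 (pderiv H1 div Z_var)) = 2 * k"
    using total_degree_gcd[OF assms(3) deg_h] by (simp add: H1 k_def)
  have k_le: "2 * k \<le> g + 1" unfolding k_def by simp
  have "pderiv H1 = 0 \<longleftrightarrow> pderiv h = 0"
    unfolding dH1 mult_eq_0_iff homogenize_eq_0_iff[OF deg_h'] by simp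
  also have "\<dots> \<longleftrightarrow> degree r = 0"
  proof
    assume "pderiv h = 0"
    hence "is_unit r" using h'_eq nz coprime_r_s by simp
    thus "degree r = 0" by (auto simp: is_unit_poly_iff)
  next
    assume "degree r = 0"
    hence "pderiv r = 0" by (auto elim: degree_eq_zeroE)
    thus "pderiv h = 0" using h'_eq pderiv_r by simp
  qed
  \<comment> \<open>As \<open>g + 1\<close> is even, \<open>degree r = 0\<close> causes no rounding,
    while \<open>degree r \<ge> 1\<close> forces \<open>2 * k \<le> g\<close>.\<close>
  also have "\<dots> \<longleftrightarrow> 2 * k = g + 1" using assms(3) unfolding k_def by (auto elim!: oddE)
  finally have k_eq: "pderiv H1 = 0 \<longleftrightarrow> 2 * k = g + 1" .
  have rank: "vec_space.rank g A = g - k" if "hasse_witt_matrix g H1 H0 A" for A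
    using rank_hasse_witt_matrix[OF h_def[symmetric] f_def[symmetric] deg_h deg_f assms(2) that]
      rank_frobenius_mat[OF deg_h] by (simp add: k_def)
  have "k \<le> g" using k_le assms(4) by simp
  hence rank': "real (vec_space.rank g A) = real g - real k" if "hasse_witt_matrix g H1 H0 A" for A
    using rank[OF that] by simp
  have k_le': "2 * real k \<le> real g + 1" using k_le by linarith
  have k_eq': "pderiv H1 = 0 \<longleftrightarrow> 2 * real k = real g + 1"
    unfolding k_eq by (intro iffI; linarith)
  show ?thesis
  proof (intro conjI exI allI impI)
    show "hasse_witt_matrix g H1 H0 (frobenius_mat g h)"
      by (rule hasse_witt_matrix_frobenius_mat[OF h_def[symmetric] f_def[symmetric] deg_h deg_f assms(2)])
  next
    fix A assume "hasse_witt_matrix g H1 H0 A"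
    note rank = rank'[OF this]
    show "real (vec_space.rank g A) = real g - 1 / 2 * real (total_degree (gcd H1 (pderiv H1 div Z_var)))"
      unfolding rank deg_gcd by simp
    show "real (vec_space.rank g A) \<ge> (real g - 1) / 2"
      unfolding rank using k_le' by simp
    show "real (vec_space.rank g A) = (real g - 1) / 2 \<longleftrightarrow> pderiv H1 = 0"
      unfolding rank k_eq' by (simp add: field_simps) linarith
  qed
qed

end
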